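(* Let $n\ge2$ and $\ell\ge1$, and let $\mathscr{M}=(\mathrm{M}_1,\ldots,\mathrm{M}_\ell)$ be a flag matroid on the ground set $[n]=\{1,\dots,n\}$. For any positive real numbers $q_1,\ldots,q_\ell\le1$, the homogeneous multivariate Tutte polynomial $$\mathrm{Z}_{q,\mathscr{M}}(w_0,w_1,\ldots,w_n):=\sum_{S\subseteq[n]}q_1^{-\operatorname{rk}_{\mathrm{M}_1}(S)}q_2^{-\operatorname{rk}_{\mathrm{M}_2}(S)}\cdots q_\ell^{-\operatorname{rk}_{\mathrm{M}_\ell}(S)}\,w_0^{\,n-|S|}\prod_{i\in S}w_i$$ is Lorentzian.
   Context: A matroid $\mathrm{M}$ on a finite set $E$ is given by its rank function $\operatorname{rk}_{\mathrm{M}}:2^E\to\mathbb{N}$ (with $\operatorname{rk}_{\mathrm M}(S)\le|S|$, monotone, submodular). For matroids $\mathrm{M},\mathrm{N}$ on the same ground set $E$, $\mathrm{N}$ is a quotient of $\mathrm{M}$ if $\operatorname{rk}_{\mathrm{N}}(S_2)-\operatorname{rk}_{\mathrm{N}}(S_1)\le\operatorname{rk}_{\mathrm{M}}(S_2)-\operatorname{rk}_{\mathrm{M}}(S_1)$ for all $S_1\subseteq S_2\subseteq E$. A flag matroid on $E$ is a sequence $(\mathrm{M}_1,\ldots,\mathrm{M}_\ell)$ of matroids on $E$ such that $\mathrm{M}_k$ is a quotient of $\mathrm{M}_{k+1}$ for all $0<k<\ell$ (equality $\mathrm{M}_k=\mathrm{M}_{k+1}$ is allowed). Lorentzian polynomials: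 a homogeneous polynomial $h$ of degree $d$ with real coefficients in a finite set of variables $w_i$ is strictly Lorentzian if all of its coefficients (i.e. those of all degree-$d$ monomials in the variables) are positive and, for any indices $i_1,\ldots,i_{d-2}$, the quadratic form $\partial_{i_1}\cdots\partial_{i_{d-2}}h$ has the Lorentzian signature $(+,-,\ldots,-)$, where $\partial_i=\partial/\partial w_i$. Lorentzian polynomials are the polynomials that can be obtained as a limit of strictly Lorentzian polynomials (of the same degree in the same variables). *)

theory Defs
  imports Complex_Main "HOL-Library.Poly_Mapping"
begin

section \<open>Matroids and flag matroids\<close>

locale matroid =
  fixes E :: "'a set" and rk :: "'a set \<Rightarrow> nat"
  assumes finite_ground: "finite E"
    and rk_le_card: "S \<subseteq> E \<Longrightarrow> rk S \<le> card S"
    and rk_mono: "S \<subseteq> T \<Longrightarrow> T \<subseteq> E \<Longrightarrow> rk S \<le> rk T"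
    and rk_submodular: "S \<subseteq> E \<Longrightarrow> T \<subseteq> E \<Longrightarrow> rk (S \<union> T) + rk (S \<inter> T) \<le> rk S + rk T"

text \<open>Only the values of a rank function on subsets of the ground set matter.\<close>

definition matroid_quotient :: "'a set \<Rightarrow> ('a set \<Rightarrow> nat) \<Rightarrow> ('a set \<Rightarrow> nat) \<Rightarrow> bool" where
  "matroid_quotient E rkN rkM \<longleftrightarrow>
     (\<forall>S1 S2. S1 \<subseteq> S2 \<and> S2 \<subseteq> E \<longrightarrow>
        int (rkN S2) - int (rkN S1) \<le> int (rkM S2) - int (rkM S1))"

text \<open>The sequence is indexed by \<open>1, \<dots>, l\<close>; other values of \<open>rk\<close> are ignored.\<close>

definition flag_matroid :: "'a set \<Rightarrow> nat \<Rightarrow> (nat \<Rightarrow> 'a set \<Rightarrow> nat) \<Rightarrow> bool" where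
  "flag_matroid E l rk \<longleftrightarrow>
     (\<forall>k\<in>{1..l}. matroid E (rk k)) \<and>
     (\<forall>k. 0 < k \<and> k < l \<longrightarrow> matroid_quotient E (rk k) (rk (k + 1)))"


section \<open>Real multivariate polynomials\<close>

text \<open>
  A monomial is its finitely supported exponent function and a polynomial is a finitely
  supported coefficient function on monomials; ring operations are those of \<open>poly_mapping\<close>.
  The variables \<open>w\<^sub>i\<close> are indexed by the elements of \<open>'v\<close>.
\<close>

type_synonym 'v rpoly = "('v \<Rightarrow>\<^sub>0 nat) \<Rightarrow>\<^sub>0 real"

definition Const :: "real \<Rightarrow> 'v rpoly" where
  "Const c = Poly_Mapping.single 0 c"

definition Var :: "'v \<Rightarrow> 'v rpoly" where
  "Var i = Poly_Mapping.single (Poly_Mapping.single i 1) 1"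

text \<open>
  Monomials without \<open>w\<^sub>i\<close> contribute \<open>0\<close> below, so the truncated subtraction of exponents
  is harmless.
\<close>

definition partial :: "'v \<Rightarrow> 'v rpoly \<Rightarrow> 'v rpoly" where
  "partial i h =
     (\<Sum>m\<in>Poly_Mapping.keys h.
        Poly_Mapping.single (m - Poly_Mapping.single i 1)
          (real (Poly_Mapping.lookup m i) * Poly_Mapping.lookup h m))"

lemma lookup_partial:
  "Poly_Mapping.lookup (partial i h) m =
     real (Poly_Mapping.lookup m i + 1) * Poly_Mapping.lookup h (m + Poly_Mapping.single i 1)"
proof -
  let ?m' = "m + Poly_Mapping.single i 1"
  have eq: "(k = ?m')" if "k - Poly_Mapping.single i 1 = m" "Poly_Mapping.lookup k i \<noteq> 0" for k
  proof (rule poly_mapping_eqI)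
    fix j
    show "Poly_Mapping.lookup k j = Poly_Mapping.lookup ?m' j"
      using that by (auto simp: lookup_add lookup_minus lookup_single when_def)
  qed
  have "Poly_Mapping.lookup (partial i h) m =
    (\<Sum>k\<in>Poly_Mapping.keys h.
       (real (Poly_Mapping.lookup k i) * Poly_Mapping.lookup h k
          when k - Poly_Mapping.single i 1 = m))"
    by (simp add: partial_def lookup_sum lookup_single)
  also have "\<dots> = (\<Sum>k\<in>Poly_Mapping.keys h.
      if k = ?m' then real (Poly_Mapping.lookup m i + 1) * Poly_Mapping.lookup h ?m' else 0)"
    by (rule sum.cong) (use eq in \<open>auto simp: when_def lookup_add\<close>)
  also have "\<dots> = real (Poly_Mapping.lookup m i + 1) * Poly_Mapping.lookup h ?m'"
    by (simp add: in_keys_iff)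
  finally show ?thesis .
qed

definition monomials :: "'v set \<Rightarrow> nat \<Rightarrow> ('v \<Rightarrow>\<^sub>0 nat) set" where
  "monomials I d =
     {m. Poly_Mapping.keys m \<subseteq> I \<and> (\<Sum>i\<in>Poly_Mapping.keys m. Poly_Mapping.lookup m i) = d}"

definition homogeneous :: "'v set \<Rightarrow> nat \<Rightarrow> 'v rpoly \<Rightarrow> bool" where
  "homogeneous I d h \<longleftrightarrow> Poly_Mapping.keys h \<subseteq> monomials I d"


section \<open>Signature of a quadratic form\<close>

text \<open>
  The quadratic form \<open>h\<close> in the variables \<open>w\<^sub>i\<close>, \<open>i \<in> I\<close>, has \<open>p\<close> positive and \<open>m\<close> negative
  squares: in suitable linear coordinates \<open>y\<^sub>i = (\<Sum>j\<in>I. A i j * w\<^sub>j)\<close>, with \<open>A\<close> an invertible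
  \<open>I \<times> I\<close> matrix, it becomes a sum of \<open>p\<close> of the \<open>y\<^sub>i\<^sup>2\<close> minus the sum of \<open>m\<close> others.
  By Sylvester's law of inertia \<open>p\<close> and \<open>m\<close> are determined by \<open>h\<close>.
\<close>

definition invertible_on :: "'v set \<Rightarrow> ('v \<Rightarrow> 'v \<Rightarrow> real) \<Rightarrow> bool" where
  "invertible_on I A \<longleftrightarrow>
     (\<exists>B. \<forall>i\<in>I. \<forall>j\<in>I.
        (\<Sum>k\<in>I. A i k * B k j) = (if i = j then 1 else 0) \<and>
        (\<Sum>k\<in>I. B i k * A k j) = (if i = j then 1 else 0))"

definition linear_form :: "'v set \<Rightarrow> ('v \<Rightarrow> real) \<Rightarrow> 'v rpoly" where
  "linear_form I a = (\<Sum>j\<in>I. Const (a j) * Var j)"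

definition has_signature :: "'v set \<Rightarrow> 'v rpoly \<Rightarrow> nat \<Rightarrow> nat \<Rightarrow> bool" where
  "has_signature I h p m \<longleftrightarrow>
     (\<exists>A P N. invertible_on I A \<and> P \<subseteq> I \<and> N \<subseteq> I \<and> P \<inter> N = {} \<and> card P = p \<and> card N = m \<and>
        h = (\<Sum>i\<in>P. linear_form I (A i) ^ 2) - (\<Sum>i\<in>N. linear_form I (A i) ^ 2))"

definition lorentzian_signature :: "'v set \<Rightarrow> 'v rpoly \<Rightarrow> bool" where
  "lorentzian_signature I h \<longleftrightarrow> has_signature I h 1 (card I - 1)"


section \<open>Lorentzian polynomials\<close>

text \<open>
  The list \<open>is\<close> is \<open>i\<^sub>1, \<dots>, i\<^bsub>d-2\<^esub>\<close>, with repetitions allowed; the signature condition is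
  void for \<open>d < 2\<close>.
\<close>

definition strictly_lorentzian :: "'v set \<Rightarrow> nat \<Rightarrow> 'v rpoly \<Rightarrow> bool" where
  "strictly_lorentzian I d h \<longleftrightarrow>
     finite I \<and> homogeneous I d h \<and>
     (\<forall>m\<in>monomials I d. Poly_Mapping.lookup h m > 0) \<and>
     (\<forall>is. set is \<subseteq> I \<and> length is + 2 = d \<longrightarrow> lorentzian_signature I (foldr partial is h))"

text \<open>
  All polynomials involved lie in the finite-dimensional space of homogeneous polynomials of
  degree \<open>d\<close> in the variables \<open>w\<^sub>i\<close>, \<open>i \<in> I\<close>, whose topology is coefficientwise convergence;
  it is metrizable, so limits of sequences give the closure.
\<close>

definition lorentzian :: "'v set \<Rightarrow> nat \<Rightarrow> 'v rpoly \<Rightarrow> bool" where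
  "lorentzian I d h \<longleftrightarrow>
     (\<exists>H :: nat \<Rightarrow> 'v rpoly. (\<forall>k. strictly_lorentzian I d (H k)) \<and>
        (\<forall>m. (\<lambda>k. Poly_Mapping.lookup (H k) m) \<longlonglongrightarrow> Poly_Mapping.lookup h m))"


section \<open>The homogeneous multivariate Tutte polynomial\<close>

definition tutte_poly ::
    "nat \<Rightarrow> nat \<Rightarrow> (nat \<Rightarrow> real) \<Rightarrow> (nat \<Rightarrow> nat set \<Rightarrow> nat) \<Rightarrow> nat rpoly" where
  "tutte_poly n l q rk =
     (\<Sum>S\<in>Pow {1..n}.
        Const (\<Prod>k\<in>{1..l}. q k powi (- int (rk k S))) * Var 0 ^ (n - card S) * (\<Prod>i\<in>S. Var i))"

end

theory Submission
  imports Defs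
begin

text \<open>
  The polynomial is the limit of an explicit two-parameter family of strictly Lorentzian
  polynomials. For a homogeneous polynomial \<open>h\<close> of degree \<open>d\<close> let \<open>a(m)\<close> be its normalized
  coefficient, that is \<open>m!\<close> times the coefficient of \<open>w\<^sup>m\<close>. The iterated derivative of \<open>h\<close> along
  a monomial \<open>\<alpha>\<close> of degree \<open>d - 2\<close> is the quadratic form with Hessian matrix
  \<open>a(\<alpha> + e\<^sub>i + e\<^sub>j)\<close>. If all \<open>a(m)\<close> are positive, this matrix has Lorentzian signature as soon as
  the Schur complement of its entry at \<open>(0, 0)\<close> is negative definite, so strict Lorentzianity
  becomes an inequality between numbers \<open>a(m)\<close>.

  Let \<open>c(S)\<close> be the coefficient that the Tutte polynomial gives to the set \<open>S\<close>. The family is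
  \<open>a(m) = (n - |S|)! c(S) \<kappa>\<^bsup>C(|S|, 2)\<^esup> \<delta>\<^bsup>D(m)\<^esup>\<close>, where \<open>S\<close> is the set of those \<open>i \<ge> 1\<close> with
  \<open>m\<^sub>i > 0\<close> and \<open>D(m)\<close> is the sum of \<open>C(m\<^sub>i, 2)\<close> over \<open>i \<ge> 1\<close>. For \<open>\<kappa> = 1\<close> and \<open>\<delta> = 0\<close> this is the
  Tutte polynomial (\<open>deformed_tutte_poly_1_0\<close>). Put \<open>b(S) = (n - |S|)! c(S) \<kappa>\<^bsup>C(|S|, 2)\<^esup>\<close>, and let
  \<open>T\<close> be the set of those \<open>i \<ge> 1\<close> with \<open>\<alpha>\<^sub>i > 0\<close>. Up to a positive factor and a rescaling of
  the coordinates, the negated Schur complement has the off-diagonal entries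
  \<open>1 - b(T) b(T \<union> {i, j}) / (b(T \<union> {i}) b(T \<union> {j}))\<close>, and its diagonal entries tend to \<open>1\<close> with
  \<open>\<delta>\<close>. An element \<open>i\<close> of \<open>T\<close> behaves like a second copy of the index \<open>0\<close>: its off-diagonal
  entries vanish. Hence only the block on the complement \<open>U\<close> of \<open>T\<close> matters, and once that
  block has a spectral gap for \<open>\<delta> = 0\<close>, all small \<open>\<delta> > 0\<close> will do
  (\<open>eventually_strictly_lorentzian_deformed\<close>).

  With \<open>N = |U|\<close>, the off-diagonal entries of this block are \<open>1 - \<kappa> N / (N - 1) (1 - K\<^sub>i\<^sub>j)\<close>, where
  \<open>K\<^sub>i\<^sub>j\<close> is \<open>1\<close> minus the product of the powers of the \<open>q\<^sub>k\<close> to the exponents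
  \<open>rk\<^sub>k{i} + rk\<^sub>k{j} - rk\<^sub>k{i, j}\<close>, the ranks being those of the contractions by \<open>T\<close>. With
  \<open>K\<^sub>i\<^sub>i = 1\<close>, the gap follows for every \<open>\<kappa> < 1\<close> from two bounds (\<open>tutte_gap\<close>):
  \<open>z\<^sup>T K z\<close> is at least \<open>(\<Sum> z\<^sub>i)\<^sup>2 / N\<close> and at least a positive multiple of \<open>\<Sum> z\<^sub>i\<^sup>2\<close>.

  Both bounds are proved by peeling off the smallest matroid of the flag
  (\<open>flag_kernel_bounds\<close>). Its loops and its nonloops do not interact in \<open>K\<close>. On its loops, \<open>K\<close> is
  the matrix \<open>K'\<close> of the remaining flag. On its nonloops, \<open>K\<close> is the convex combination
  \<open>q\<^sub>1 K' + (1 - q\<^sub>1) P\<close>, where \<open>P\<close> is the indicator matrix of being parallel, for which the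
  bounds follow from the Cauchy-Schwarz inequality. The quotient condition enters here: if
  adding \<open>j\<close> to \<open>i\<close> raises the rank in the smallest matroid, then it does so in all the others.
\<close>

section \<open>Diagonalization of quadratic forms\<close>

definition qform :: "'v set \<Rightarrow> ('v \<Rightarrow> 'v \<Rightarrow> real) \<Rightarrow> ('v \<Rightarrow> real) \<Rightarrow> real" where
  "qform I M x = (\<Sum>i\<in>I. \<Sum>j\<in>I. M i j * x i * x j)"

definition positive_definite :: "'v set \<Rightarrow> ('v \<Rightarrow> 'v \<Rightarrow> real) \<Rightarrow> bool" where
  "positive_definite I M \<longleftrightarrow> (\<forall>x. (\<exists>i\<in>I. x i \<noteq> 0) \<longrightarrow> qform I M x > 0)"

definition symmetric_on :: "'v set \<Rightarrow> ('v \<Rightarrow> 'v \<Rightarrow> real) \<Rightarrow> bool" where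
  "symmetric_on I M \<longleftrightarrow> (\<forall>i\<in>I. \<forall>j\<in>I. M i j = M j i)"

lemma symmetric_onD: "symmetric_on I M \<Longrightarrow> i \<in> I \<Longrightarrow> j \<in> I \<Longrightarrow> M i j = M j i"
  unfolding symmetric_on_def by blast

definition schur_complement :: "'v \<Rightarrow> ('v \<Rightarrow> 'v \<Rightarrow> real) \<Rightarrow> 'v \<Rightarrow> 'v \<Rightarrow> real" where
  "schur_complement p M i j = M i j - M p i * M p j / M p p"

lemma qform_cong:
  assumes "\<And>i j. i \<in> I \<Longrightarrow> j \<in> I \<Longrightarrow> M i j = N i j"
  shows "qform I M x = qform I N x"
  unfolding qform_def using assms by (intro sum.cong refl) simp

lemma qform_add:
  "qform I (\<lambda>i j. M i j + N i j) x = qform I M x + qform I N x"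
  by (simp add: qform_def distrib_right sum.distrib)

lemma qform_diff:
  "qform I (\<lambda>i j. M i j - N i j) x = qform I M x - qform I N x"
  by (simp add: qform_def left_diff_distrib sum_subtractf)

lemma qform_mult:
  "qform I (\<lambda>i j. c * M i j) x = c * qform I M x"
  by (simp add: qform_def sum_distrib_left mult.assoc)

lemma qform_scale:
  "qform I (\<lambda>i j. c * (M i j * s i * s j)) x = c * qform I M (\<lambda>i. s i * x i)"
  by (simp add: qform_def sum_distrib_left mult_ac)

lemma qform_one: "qform I (\<lambda>_ _. 1) x = (\<Sum>i\<in>I. x i)\<^sup>2"
  by (simp add: qform_def power2_eq_square sum_product)

lemma qform_diagonal:
  assumes "finite I"
  shows "qform I (\<lambda>i j. if i = j then t i else 0) x = (\<Sum>i\<in>I. t i * (x i)\<^sup>2)"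
proof -
  have "(\<Sum>j\<in>I. (if i = j then t i else 0) * x i * x j) = t i * (x i)\<^sup>2" if "i \<in> I" for i
  proof -
    have "(\<Sum>j\<in>I. (if i = j then t i else 0) * x i * x j)
        = (\<Sum>j\<in>I. if i = j then t i * x i * x j else 0)"
      by (rule sum.cong) auto
    then show ?thesis using assms that by (simp add: power2_eq_square)
  qed
  then show ?thesis by (simp add: qform_def)
qed

lemma qform_union_disjoint:
  assumes "finite A" "finite B" "A \<inter> B = {}"
    and "\<And>i j. i \<in> A \<Longrightarrow> j \<in> B \<Longrightarrow> M i j = 0" "\<And>i j. i \<in> A \<Longrightarrow> j \<in> B \<Longrightarrow> M j i = 0"
  shows "qform (A \<union> B) M x = qform A M x + qform B M x"
proof -
  have "(\<Sum>j\<in>A \<union> B. M i j * x i * x j) = (\<Sum>j\<in>A. M i j * x i * x j)" if "i \<in> A" for i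
    using that assms by (simp add: sum.union_disjoint)
  moreover have "(\<Sum>j\<in>A \<union> B. M i j * x i * x j) = (\<Sum>j\<in>B. M i j * x i * x j)" if "i \<in> B" for i
    using that assms by (simp add: sum.union_disjoint)
  ultimately show ?thesis
    using assms(1-3) by (simp add: qform_def sum.union_disjoint)
qed

lemma qform_same_class:
  assumes "finite A"
  shows "qform A (\<lambda>i j. if f i = f j then 1 else 0) z = (\<Sum>c\<in>f ` A. (\<Sum>i\<in>{i\<in>A. f i = c}. z i)\<^sup>2)"
proof -
  have "(\<Sum>j\<in>A. (if f i = f j then 1 else 0) * z i * z j) = z i * (\<Sum>j\<in>{j\<in>A. f j = f i}. z j)"
    for i
  proof -
    have "(\<Sum>j\<in>A. (if f i = f j then 1 else 0) * z i * z j)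
        = (\<Sum>j\<in>A. if f j = f i then z i * z j else 0)"
      by (rule sum.cong) auto
    then show ?thesis
      using sum.inter_filter[OF assms, of "\<lambda>j. z i * z j" "\<lambda>j. f j = f i"]
      by (simp add: sum_distrib_left)
  qed
  then have "qform A (\<lambda>i j. if f i = f j then 1 else 0) z
      = (\<Sum>i\<in>A. z i * (\<Sum>j\<in>{j\<in>A. f j = f i}. z j))"
    by (simp add: qform_def)
  also have "\<dots> = (\<Sum>c\<in>f ` A. \<Sum>i\<in>{i\<in>A. f i = c}. z i * (\<Sum>j\<in>{j\<in>A. f j = f i}. z j))"
    by (rule sum.image_gen[OF assms])
  also have "\<dots> = (\<Sum>c\<in>f ` A. (\<Sum>i\<in>{i\<in>A. f i = c}. z i)\<^sup>2)"
    by (rule sum.cong) (simp_all add: power2_eq_square sum_distrib_right)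
  finally show ?thesis .
qed

lemma sum_squared_le_card:
  fixes f :: "'v \<Rightarrow> real"
  assumes "finite A"
  shows "(\<Sum>i\<in>A. f i)\<^sup>2 \<le> real (card A) * (\<Sum>i\<in>A. (f i)\<^sup>2)"
proof -
  have "0 \<le> (\<Sum>i\<in>A. \<Sum>j\<in>A. (f i - f j)\<^sup>2)" by (intro sum_nonneg) simp
  also have "\<dots> = 2 * (real (card A) * (\<Sum>i\<in>A. (f i)\<^sup>2)) - 2 * (\<Sum>i\<in>A. f i)\<^sup>2"
    by (simp add: power2_diff sum.distrib sum_subtractf sum_product power2_eq_square
        sum_distrib_left algebra_simps)
  finally show ?thesis by simp
qed

text \<open>
  On each fibre of \<open>f\<close> the form is the square of a sum, and the number of fibres is at most the
  number of elements.
\<close>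

lemma qform_same_class_bounds:
  fixes z :: "'v \<Rightarrow> real"
  assumes "finite A"
  shows "(\<Sum>i\<in>A. z i)\<^sup>2 \<le> real (card A) * qform A (\<lambda>i j. if f i = f j then 1 else 0) z"
    and "0 \<le> qform A (\<lambda>i j. if f i = f j then 1 else 0) z"
proof -
  let ?Q = "qform A (\<lambda>i j. if f i = f j then 1 else 0) z"
  show nonneg: "0 \<le> ?Q"
    unfolding qform_same_class[OF assms] by (intro sum_nonneg) simp
  have "(\<Sum>i\<in>A. z i)\<^sup>2 = (\<Sum>c\<in>f ` A. \<Sum>i\<in>{i\<in>A. f i = c}. z i)\<^sup>2"
    using sum.image_gen[OF assms, of z f] by simp
  also have "\<dots> \<le> real (card (f ` A)) * ?Q"
    unfolding qform_same_class[OF assms] using assms by (intro sum_squared_le_card) simp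
  also have "\<dots> \<le> real (card A) * ?Q"
    using nonneg card_image_le[OF assms, of f] by (intro mult_right_mono) auto
  finally show "(\<Sum>i\<in>A. z i)\<^sup>2 \<le> real (card A) * ?Q" .
qed

text \<open>
  Isolating the variable \<open>x\<^sub>p\<close> is the preparation for completing the square.
\<close>

lemma qform_insert:
  assumes "finite J" "p \<notin> J" "symmetric_on (insert p J) M"
  shows "qform (insert p J) M x
       = M p p * (x p)\<^sup>2 + 2 * x p * (\<Sum>j\<in>J. M p j * x j) + qform J M x"
proof -
  have "M i p = M p i" if "i \<in> J" for i
    using symmetric_onD[OF assms(3)] that by blast
  then have "(\<Sum>i\<in>J. M i p * x i * x p) = x p * (\<Sum>j\<in>J. M p j * x j)"
    unfolding sum_distrib_left by (intro sum.cong) (simp_all add: mult_ac)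
  moreover have "(\<Sum>j\<in>J. M p j * x p * x j) = x p * (\<Sum>j\<in>J. M p j * x j)"
    unfolding sum_distrib_left by (intro sum.cong) (simp_all add: mult_ac)
  ultimately show ?thesis
    using assms(1,2) by (simp add: qform_def sum.distrib power2_eq_square algebra_simps)
qed

lemma qform_schur_complement:
  "qform J (schur_complement p M) x = qform J M x - (\<Sum>j\<in>J. M p j * x j)\<^sup>2 / M p p"
proof -
  have "(\<Sum>i\<in>J. \<Sum>j\<in>J. M p i * M p j / M p p * x i * x j) = (\<Sum>j\<in>J. M p j * x j)\<^sup>2 / M p p"
    by (simp add: power2_eq_square sum_product sum_divide_distrib algebra_simps)
  then show ?thesis
    by (simp add: qform_def schur_complement_def left_diff_distrib sum_subtractf)
qed

lemma positive_definite_schur_complement: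
  assumes "finite J" "p \<notin> J" "symmetric_on (insert p J) M" "positive_definite (insert p J) M"
  shows "M p p > 0" "positive_definite J (schur_complement p M)"
proof -
  have "qform (insert p J) M (\<lambda>i. if i = p then 1 else 0) > 0"
    using assms(4) by (auto simp: positive_definite_def)
  moreover have "(\<Sum>j\<in>J. M p j * (if j = p then 1 else 0)) = 0"
    "qform J M (\<lambda>i. if i = p then 1 else 0) = 0"
    using assms(2) by (auto simp: qform_def intro!: sum.neutral)
  ultimately show pos: "M p p > 0"
    by (simp add: qform_insert[OF assms(1-3)])
  show "positive_definite J (schur_complement p M)"
    unfolding positive_definite_def
  proof (intro allI impI)
    fix x :: "'a \<Rightarrow> real" assume x: "\<exists>i\<in>J. x i \<noteq> 0"
    define s where "s = (\<Sum>j\<in>J. M p j * x j)"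
    \<comment> \<open>This value of the new coordinate minimizes the form, which leaves the Schur complement.\<close>
    define y where "y = x(p := - s / M p p)"
    have "\<exists>i\<in>insert p J. y i \<noteq> 0" using x assms(2) by (auto simp: y_def)
    then have "qform (insert p J) M y > 0" using assms(4) by (auto simp: positive_definite_def)
    moreover have "(\<Sum>j\<in>J. M p j * y j) = s" "qform J M y = qform J M x"
      using assms(2) by (auto simp: y_def s_def qform_def intro!: sum.cong)
    moreover have "y p = - s / M p p" by (simp add: y_def)
    ultimately have "0 < M p p * (- s / M p p)\<^sup>2 + 2 * (- s / M p p) * s + qform J M x"
      by (simp add: qform_insert[OF assms(1-3)])
    also have "\<dots> = qform J M x - s\<^sup>2 / M p p"
      using pos by (simp add: power2_eq_square)
    finally show "qform J (schur_complement p M) x > 0"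
      by (simp add: qform_schur_complement s_def)
  qed
qed

text \<open>
  One step of a triangular change of coordinates: a row \<open>r\<close> is put on top of an invertible
  matrix \<open>C\<close>. The inverse is written down by blocks.
\<close>

lemma invertible_on_border:
  assumes "finite J" "p \<notin> J" "invertible_on J C" "r p \<noteq> 0"
  shows "invertible_on (insert p J) (\<lambda>i j. if i = p then r j else if j = p then 0 else C i j)"
    (is "invertible_on _ ?A")
proof -
  obtain D where CD: "\<And>i j. i \<in> J \<Longrightarrow> j \<in> J \<Longrightarrow> (\<Sum>k\<in>J. C i k * D k j) = (if i = j then 1 else 0)"
    and DC: "\<And>i j. i \<in> J \<Longrightarrow> j \<in> J \<Longrightarrow> (\<Sum>k\<in>J. D i k * C k j) = (if i = j then 1 else 0)"
    using assms(3) unfolding invertible_on_def by blast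
  define B where "B i j = (if i = p then (if j = p then 1 / r p else - (\<Sum>k\<in>J. r k * D k j) / r p)
      else if j = p then 0 else D i j)" for i j
  have ne: "\<And>k. k \<in> J \<Longrightarrow> k \<noteq> p" using assms(2) by auto
  have out: "(\<Sum>k\<in>J. B p k * C k j) = - r j / r p" if "j \<in> J" for j
  proof -
    have "(\<Sum>k\<in>J. B p k * C k j) = (\<Sum>k\<in>J. - (\<Sum>l\<in>J. r l * D l k) / r p * C k j)"
      by (rule sum.cong) (simp_all add: B_def ne)
    also have "\<dots> = - (\<Sum>k\<in>J. \<Sum>l\<in>J. r l * (D l k * C k j)) / r p"
      by (simp add: sum_distrib_right sum_divide_distrib sum_negf mult.assoc)
    also have "(\<Sum>k\<in>J. \<Sum>l\<in>J. r l * (D l k * C k j)) = (\<Sum>l\<in>J. r l * (\<Sum>k\<in>J. D l k * C k j))"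
      by (subst sum.swap) (simp add: sum_distrib_left)
    also have "\<dots> = (\<Sum>l\<in>J. if l = j then r l else 0)"
      by (rule sum.cong) (use that DC in auto)
    also have "\<dots> = r j" using assms(1) that by simp
    finally show ?thesis .
  qed
  have "(\<Sum>k\<in>insert p J. ?A i k * B k j) = (if i = j then 1 else 0) \<and>
        (\<Sum>k\<in>insert p J. B i k * ?A k j) = (if i = j then 1 else 0)"
    if i: "i \<in> insert p J" and j: "j \<in> insert p J" for i j
  proof -
    have sum1: "(\<Sum>k\<in>J. ?A i k * B k j) =
      (if j = p then 0 else if i = p then (\<Sum>k\<in>J. r k * D k j) else (\<Sum>k\<in>J. C i k * D k j))"
      using i j by (simp add: B_def ne cong: sum.cong)
    have sum2: "(\<Sum>k\<in>J. B i k * ?A k j) =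
      (if j = p then 0 else if i = p then (\<Sum>k\<in>J. B p k * C k j) else (\<Sum>k\<in>J. D i k * C k j))"
      using i j by (simp add: B_def ne cong: sum.cong)
    note sums = sum.insert[OF assms(1,2)] sum1 sum2
    have B: "B p p = 1 / r p" "\<And>l. l \<in> J \<Longrightarrow> B p l = - (\<Sum>k\<in>J. r k * D k l) / r p"
      "\<And>k. k \<in> J \<Longrightarrow> B k p = 0" "\<And>k l. k \<in> J \<Longrightarrow> l \<in> J \<Longrightarrow> B k l = D k l"
      by (simp_all add: B_def ne)
    consider "i = p" "j = p" | "i = p" "j \<in> J" | "i \<in> J" "j = p" | "i \<in> J" "j \<in> J"
      using i j by blast
    then show ?thesis
    proof cases
      case 1
      then show ?thesis using assms(4) unfolding sums by (simp add: B)
    next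
      case 2
      then show ?thesis
        using assms(4) ne[OF 2(2)] unfolding sums by (simp add: out B(1)) (simp add: B)
    next
      case 3
      then show ?thesis using ne[OF 3(1)] unfolding sums by (simp add: B)
    next
      case 4
      then show ?thesis using ne CD DC unfolding sums by (simp add: B)
    qed
  qed
  then show ?thesis unfolding invertible_on_def by (intro exI[of _ B]) simp
qed

text \<open>
  Completing the square at \<open>p\<close>: the new coordinate is row \<open>p\<close> of \<open>M\<close> divided by the root of the
  pivot, and what remains is the Schur complement on \<open>J\<close>. The signs \<open>s\<close> allow the step to serve
  both for definite forms and for Lorentzian ones.
\<close>

lemma diagonalization_step:
  assumes "finite J" "p \<notin> J" "symmetric_on (insert p J) M" "M p p > 0" "invertible_on J C"
    and C: "\<And>i j. i \<in> J \<Longrightarrow> j \<in> J \<Longrightarrow> schur_complement p M i j = (\<Sum>k\<in>J. s k * C k i * C k j)"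
  obtains A where "invertible_on (insert p J) A"
    and "\<And>i j. i \<in> insert p J \<Longrightarrow> j \<in> insert p J \<Longrightarrow>
           M i j = A p i * A p j + (\<Sum>k\<in>J. s k * A k i * A k j)"
proof -
  define r where "r j = M p j / sqrt (M p p)" for j
  define A where "A i j = (if i = p then r j else if j = p then 0 else C i j)" for i j
  have rr: "r i * r j = M p i * M p j / M p p" for i j
    using assms(4) by (simp add: r_def)
  have "r p \<noteq> 0" using assms(4) by (simp add: r_def)
  then have inv: "invertible_on (insert p J) A"
    using invertible_on_border[OF assms(1,2,5), of r] by (simp add: A_def[abs_def])
  have "M i j = A p i * A p j + (\<Sum>k\<in>J. s k * A k i * A k j)"
    if i: "i \<in> insert p J" and j: "j \<in> insert p J" for i j
  proof -
    have "(\<Sum>k\<in>J. s k * A k i * A k j)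
        = (if i = p \<or> j = p then 0 else (\<Sum>k\<in>J. s k * C k i * C k j))"
      using assms(2) by (auto simp: A_def intro!: sum.cong sum.neutral)
    moreover have "M i p = M p i" using symmetric_onD[OF assms(3)] i by blast
    ultimately show ?thesis
      using i j assms(4) C[of i j] rr[of i j]
      by (auto simp: A_def schur_complement_def)
  qed
  with inv show thesis by (rule that)
qed

lemma symmetric_on_schur_complement:
  assumes "symmetric_on (insert p J) M"
  shows "symmetric_on J (schur_complement p M)"
  unfolding symmetric_on_def schur_complement_def
proof (intro ballI)
  fix i j assume "i \<in> J" "j \<in> J"
  then have "M i j = M j i" using symmetric_onD[OF assms] by blast
  then show "M i j - M p i * M p j / M p p = M j i - M p j * M p i / M p p"
    by (simp add: mult.commute)
qed

lemma cholesky: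
  assumes "finite I" "symmetric_on I M" "positive_definite I M"
  shows "\<exists>A. invertible_on I A \<and> (\<forall>i\<in>I. \<forall>j\<in>I. M i j = (\<Sum>k\<in>I. A k i * A k j))"
  using assms
proof (induction I arbitrary: M rule: finite_induct)
  case empty
  show ?case by (simp add: invertible_on_def)
next
  case (insert p J)
  note pd = positive_definite_schur_complement[OF insert.hyps insert.prems]
  obtain C where C: "invertible_on J C"
    "\<forall>i\<in>J. \<forall>j\<in>J. schur_complement p M i j = (\<Sum>k\<in>J. C k i * C k j)"
    using insert.IH[OF symmetric_on_schur_complement[OF insert.prems(1)] pd(2)] by blast
  obtain A where "invertible_on (insert p J) A"
    "\<And>i j. i \<in> insert p J \<Longrightarrow> j \<in> insert p J \<Longrightarrow>
       M i j = A p i * A p j + (\<Sum>k\<in>J. 1 * A k i * A k j)"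
    using diagonalization_step[OF insert.hyps insert.prems(1) pd(1) C(1), of "\<lambda>_. 1"] C(2)
    by auto
  then show ?case using insert.hyps by (intro exI[of _ A]) simp
qed

lemma lorentzian_diagonalization:
  assumes "finite J" "p \<notin> J" "symmetric_on (insert p J) M" "M p p > 0"
    and "positive_definite J (\<lambda>i j. - schur_complement p M i j)"
  obtains A where "invertible_on (insert p J) A"
    and "\<And>i j. i \<in> insert p J \<Longrightarrow> j \<in> insert p J \<Longrightarrow>
           M i j = A p i * A p j - (\<Sum>k\<in>J. A k i * A k j)"
proof -
  have "symmetric_on J (\<lambda>i j. - schur_complement p M i j)"
    using symmetric_on_schur_complement[OF assms(3)] by (simp add: symmetric_on_def)
  then obtain C where C: "invertible_on J C"
    "\<forall>i\<in>J. \<forall>j\<in>J. - schur_complement p M i j = (\<Sum>k\<in>J. C k i * C k j)"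
    using cholesky[OF assms(1) _ assms(5)] by blast
  have "schur_complement p M i j = (\<Sum>k\<in>J. - 1 * C k i * C k j)" if "i \<in> J" "j \<in> J" for i j
  proof -
    have "- schur_complement p M i j = (\<Sum>k\<in>J. C k i * C k j)" using C(2) that by blast
    then show ?thesis by (simp add: sum_negf)
  qed
  from diagonalization_step[OF assms(1-4) C(1) this]
  obtain A where "invertible_on (insert p J) A"
    "\<And>i j. i \<in> insert p J \<Longrightarrow> j \<in> insert p J \<Longrightarrow>
       M i j = A p i * A p j + (\<Sum>k\<in>J. - 1 * A k i * A k j)"
    by blast
  then show thesis using that[of A] by (simp add: sum_negf)
qed

section \<open>Normalized coefficients and strictly Lorentzian polynomials\<close>

text \<open>
  The exponent of the single variable \<open>w\<^sub>i\<close>. It is a constant of its own so that rewriting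
  the numeral \<open>1\<close> to \<open>Suc 0\<close> does not hide it from the lemmas below.
\<close>

definition unit_exp :: "'v \<Rightarrow> ('v \<Rightarrow>\<^sub>0 nat)" where
  "unit_exp i = Poly_Mapping.single i 1"

lemma lookup_unit_exp: "Poly_Mapping.lookup (unit_exp i) j = (if i = j then 1 else 0)"
  by (simp add: unit_exp_def lookup_single when_def)

lemma keys_add_unit_exp: "Poly_Mapping.keys (m + unit_exp i) = insert i (Poly_Mapping.keys m)"
  by (auto simp: in_keys_iff lookup_add lookup_unit_exp split: if_splits)

lemma unit_exp_add_eq_iff:
  "unit_exp i + unit_exp j = unit_exp a + unit_exp b \<longleftrightarrow> (i = a \<and> j = b) \<or> (i = b \<and> j = a)"
proof
  assume eq: "unit_exp i + unit_exp j = unit_exp a + unit_exp b"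
  have l: "(if i = k then 1 else 0) + (if j = k then 1 else 0)
      = (if a = k then 1 else 0) + (if b = k then 1 else (0::nat))" for k
    using arg_cong[OF eq, of "\<lambda>m. Poly_Mapping.lookup m k"] by (simp add: lookup_add lookup_unit_exp)
  have "i = a \<or> i = b" using l[of i] by (simp split: if_splits)
  then show "(i = a \<and> j = b) \<or> (i = b \<and> j = a)"
  proof
    assume "i = a"
    then have "j = b" using l[of j] by (simp split: if_splits)
    with \<open>i = a\<close> show ?thesis by simp
  next
    assume "i = b"
    then have "j = a" using l[of j] by (simp split: if_splits)
    with \<open>i = b\<close> show ?thesis by simp
  qed
qed (auto simp: add.commute)

lemma monomials_iff:
  assumes "finite I"
  shows "m \<in> monomials I d \<longleftrightarrow>
    Poly_Mapping.keys m \<subseteq> I \<and> (\<Sum>i\<in>I. Poly_Mapping.lookup m i) = d"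
proof -
  have "(\<Sum>i\<in>Poly_Mapping.keys m. Poly_Mapping.lookup m i) = (\<Sum>i\<in>I. Poly_Mapping.lookup m i)"
    if "Poly_Mapping.keys m \<subseteq> I"
    by (rule sum.mono_neutral_left) (use assms that in \<open>auto simp: in_keys_iff\<close>)
  then show ?thesis by (auto simp: monomials_def)
qed

lemma add_unit_exp_in_monomials:
  assumes "finite I" "i \<in> I"
  shows "m + unit_exp i \<in> monomials I (Suc d) \<longleftrightarrow> m \<in> monomials I d"
  using assms by (simp add: monomials_iff keys_add_unit_exp lookup_add lookup_unit_exp sum.distrib)

lemma monomials_0: "monomials I 0 = {0}"
proof -
  have "m = 0" if "m \<in> monomials I 0" for m
    using that by (intro poly_mapping_eqI) (auto simp: monomials_def in_keys_iff)
  then show ?thesis by (auto simp: monomials_def)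
qed

lemma monomials_SucE:
  assumes "finite I" "m \<in> monomials I (Suc d)"
  obtains i m' where "i \<in> I" "m' \<in> monomials I d" "m = m' + unit_exp i"
proof -
  have "(\<Sum>i\<in>I. Poly_Mapping.lookup m i) \<noteq> 0"
    using assms by (simp add: monomials_iff)
  then obtain i where i: "i \<in> I" "Poly_Mapping.lookup m i \<noteq> 0"
    by (meson sum.neutral)
  have "m = (m - unit_exp i) + unit_exp i"
    using i(2) by (intro poly_mapping_eqI) (auto simp: lookup_add lookup_minus lookup_unit_exp)
  with assms i show thesis
    by (metis that add_unit_exp_in_monomials)
qed

lemma finite_monomials:
  assumes "finite I" shows "finite (monomials I d)"
proof (induction d)
  case (Suc d)
  have "monomials I (Suc d) \<subseteq> (\<lambda>(m, i). m + unit_exp i) ` (monomials I d \<times> I)"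
    by (force elim: monomials_SucE[OF assms])
  then show ?case using Suc assms by (meson finite_SigmaI finite_imageI finite_subset)
qed (simp add: monomials_0)

lemma homogeneous_iff:
  "homogeneous I d h \<longleftrightarrow> (\<forall>m. Poly_Mapping.lookup h m \<noteq> 0 \<longrightarrow> m \<in> monomials I d)"
  by (auto simp: homogeneous_def in_keys_iff)

lemma lookup_partial_unit_exp:
  "Poly_Mapping.lookup (partial i h) m
     = real (Poly_Mapping.lookup m i + 1) * Poly_Mapping.lookup h (m + unit_exp i)"
  by (simp only: lookup_partial unit_exp_def)

lemma homogeneous_partial:
  assumes "finite I" "i \<in> I" "homogeneous I (Suc d) h"
  shows "homogeneous I d (partial i h)"
  using assms(3) add_unit_exp_in_monomials[OF assms(1,2)]
  by (auto simp: homogeneous_iff lookup_partial_unit_exp)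

lemma homogeneous_foldr_partial:
  assumes "finite I" "set is \<subseteq> I" "homogeneous I (length is + d) h"
  shows "homogeneous I d (foldr partial is h)"
  using assms(2,3)
proof (induction "is" arbitrary: d)
  case (Cons i "is")
  then have "homogeneous I (Suc d) (foldr partial is h)" by simp
  then show ?case using homogeneous_partial[OF assms(1)] Cons.prems(1) by simp
qed simp

text \<open>
  The factorial \<open>m!\<close> of a multi-index.
\<close>

definition mfact :: "'v set \<Rightarrow> ('v \<Rightarrow>\<^sub>0 nat) \<Rightarrow> real" where
  "mfact I m = (\<Prod>i\<in>I. fact (Poly_Mapping.lookup m i))"

lemma mfact_pos: "mfact I m > 0"
  unfolding mfact_def by (intro prod_pos) simp

lemma mfact_0: "mfact I 0 = 1"
  by (simp add: mfact_def)

lemma mfact_add_unit_exp: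
  assumes "finite I" "i \<in> I"
  shows "mfact I (m + unit_exp i) = real (Poly_Mapping.lookup m i + 1) * mfact I m"
proof -
  have "(\<Prod>j\<in>I - {i}. fact (Poly_Mapping.lookup (m + unit_exp i) j) :: real)
      = (\<Prod>j\<in>I - {i}. fact (Poly_Mapping.lookup m j))"
    by (rule prod.cong) (auto simp: lookup_add lookup_unit_exp)
  then show ?thesis
    using assms by (simp add: mfact_def prod.remove[of I i] lookup_add lookup_unit_exp)
qed

definition normalized_coeff :: "'v set \<Rightarrow> 'v rpoly \<Rightarrow> ('v \<Rightarrow>\<^sub>0 nat) \<Rightarrow> real" where
  "normalized_coeff I h m = mfact I m * Poly_Mapping.lookup h m"

text \<open>
  This is the purpose of the normalization. Differentiation becomes a shift, because the exponent
  brought down by the derivative is the quotient of the two factorials.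
\<close>

lemma normalized_coeff_partial:
  assumes "finite I" "i \<in> I"
  shows "normalized_coeff I (partial i h) m = normalized_coeff I h (m + unit_exp i)"
  unfolding normalized_coeff_def lookup_partial_unit_exp mfact_add_unit_exp[OF assms] by simp

lemma normalized_coeff_foldr_partial:
  assumes "finite I" "set is \<subseteq> I"
  shows "normalized_coeff I (foldr partial is h) m
       = normalized_coeff I h (m + (\<Sum>i\<leftarrow>is. unit_exp i))"
  using assms(2)
  by (induction "is" arbitrary: m) (simp_all add: normalized_coeff_partial[OF assms(1)] add.assoc)

lemma sum_list_unit_exp_in_monomials:
  assumes "finite I" "set is \<subseteq> I"
  shows "(\<Sum>i\<leftarrow>is. unit_exp i) \<in> monomials I (length is)"
  using assms(2)
  by (induction "is") (simp_all add: monomials_0 add.commute[of "unit_exp _"]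
        add_unit_exp_in_monomials[OF assms(1)])

text \<open>
  A quadratic form is half of the value of its Hessian bilinear form at \<open>(w, w)\<close>. The monomial
  \<open>w\<^sub>a w\<^sub>b\<close> is met twice in the double sum if \<open>a \<noteq> b\<close> and once if \<open>a = b\<close>, and the factorial
  makes up for the difference.
\<close>

lemma quadratic_expansion:
  assumes "finite I" "homogeneous I 2 h"
  shows "Poly_Mapping.lookup h m = (\<Sum>i\<in>I. \<Sum>j\<in>I.
      normalized_coeff I h (unit_exp i + unit_exp j) / 2 when unit_exp i + unit_exp j = m)"
proof (cases "m \<in> monomials I 2")
  case False
  have "unit_exp i + unit_exp j \<noteq> m" if "i \<in> I" "j \<in> I" for i j
  proof -
    have "0 + unit_exp i + unit_exp j \<in> monomials I (Suc (Suc 0))"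
      using that by (simp only: add_unit_exp_in_monomials[OF assms(1)]) (simp add: monomials_0)
    then show ?thesis using False by (auto simp: numeral_2_eq_2)
  qed
  then have "(\<Sum>i\<in>I. \<Sum>j\<in>I.
      normalized_coeff I h (unit_exp i + unit_exp j) / 2 when unit_exp i + unit_exp j = m) = 0"
    by (intro sum.neutral ballI) simp
  moreover have "Poly_Mapping.lookup h m = 0"
    using False assms(2) by (auto simp: homogeneous_iff)
  ultimately show ?thesis by simp
next
  case True
  then obtain a m' where a: "a \<in> I" "m' \<in> monomials I (Suc 0)" "m = m' + unit_exp a"
    using monomials_SucE[OF assms(1)] by (metis numeral_2_eq_2)
  from a(2) obtain b where b: "b \<in> I" "m = unit_exp b + unit_exp a"
    using monomials_SucE[OF assms(1), of m' 0] a(3) by (metis add_0 monomials_0 singletonD)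
  have "(\<Sum>i\<in>I. \<Sum>j\<in>I.
      normalized_coeff I h (unit_exp i + unit_exp j) / 2 when unit_exp i + unit_exp j = m)
    = (\<Sum>z\<in>I \<times> I. if z \<in> {(a, b), (b, a)} then normalized_coeff I h m / 2 else 0)"
    unfolding sum.cartesian_product
    by (rule sum.cong) (auto simp: when_def b(2) unit_exp_add_eq_iff add.commute split: if_splits)
  also have "\<dots> = (\<Sum>z\<in>{(a, b), (b, a)}. normalized_coeff I h m / 2)"
    using a(1) b(1) assms(1) by (intro sum.mono_neutral_cong_right) auto
  also have "\<dots> = real (card {(a, b), (b, a)}) * (mfact I m / 2) * Poly_Mapping.lookup h m"
    by (simp add: normalized_coeff_def)
  also have "mfact I m = (if a = b then 2 else 1)"
    using mfact_add_unit_exp[OF assms(1) a(1), of "unit_exp b"]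
      mfact_add_unit_exp[OF assms(1) b(1), of 0]
    by (simp add: b(2) mfact_0 lookup_unit_exp)
  finally show ?thesis by (auto split: if_splits)
qed

lemma lookup_linear_form_square:
  "Poly_Mapping.lookup ((linear_form I a)\<^sup>2) m
     = (\<Sum>i\<in>I. \<Sum>j\<in>I. a i * a j when unit_exp i + unit_exp j = m)"
proof -
  have "linear_form I a = (\<Sum>j\<in>I. Poly_Mapping.single (unit_exp j) (a j))"
    by (simp only: linear_form_def Const_def Var_def unit_exp_def mult_single add_0 mult_1_right)
  then show ?thesis
    by (simp add: power2_eq_square sum_product mult_single lookup_sum lookup_single)
qed

text \<open>
  The positive square comes from the pivot \<open>p\<close>, and the negative definite Schur complement
  supplies a negative square for every other index.
\<close>

lemma lorentzian_signatureI:
  assumes "finite J" "p \<notin> J" "homogeneous (insert p J) 2 h"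
    and M: "\<And>i j. i \<in> insert p J \<Longrightarrow> j \<in> insert p J \<Longrightarrow>
        normalized_coeff (insert p J) h (unit_exp i + unit_exp j) = M i j"
    and pos: "M p p > 0"
    and neg: "positive_definite J (\<lambda>i j. - schur_complement p M i j)"
  shows "lorentzian_signature (insert p J) h"
proof -
  let ?I = "insert p J"
  \<comment> \<open>The matrix of a quadratic form is half of its Hessian.\<close>
  define H where "H i j = M i j / 2" for i j
  have "M i j = M j i" if "i \<in> ?I" "j \<in> ?I" for i j
    using M[OF that] M[OF that(2,1)] by (metis add.commute)
  then have sym: "symmetric_on ?I H"
    unfolding symmetric_on_def H_def by (metis)
  have "schur_complement p H i j = schur_complement p M i j / 2" for i j
    by (simp add: H_def schur_complement_def diff_divide_distrib)
  then have half: "qform J (\<lambda>i j. - schur_complement p H i j) x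
      = qform J (\<lambda>i j. - schur_complement p M i j) x / 2" for x
    unfolding qform_def sum_divide_distrib
    by (intro sum.cong refl) simp
  then have "positive_definite J (\<lambda>i j. - schur_complement p H i j)"
    using neg unfolding positive_definite_def half by simp
  moreover have "H p p > 0" using pos by (simp add: H_def)
  ultimately obtain A where A: "invertible_on ?I A"
    "\<And>i j. i \<in> ?I \<Longrightarrow> j \<in> ?I \<Longrightarrow> H i j = A p i * A p j - (\<Sum>k\<in>J. A k i * A k j)"
    using lorentzian_diagonalization[OF assms(1,2) sym] by blast
  have "h = (\<Sum>i\<in>{p}. linear_form ?I (A i) ^ 2) - (\<Sum>i\<in>J. linear_form ?I (A i) ^ 2)"
  proof (rule poly_mapping_eqI)
    fix m
    define c :: "'a \<Rightarrow> 'a \<Rightarrow> real" where "c i j = (1 when unit_exp i + unit_exp j = m)" for i j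
    have c: "(t when unit_exp i + unit_exp j = m) = t * c i j" for t i j
      by (simp add: c_def when_def)
    have "(\<Sum>k\<in>J. \<Sum>i\<in>?I. \<Sum>j\<in>?I. A k i * A k j * c i j)
        = (\<Sum>i\<in>?I. \<Sum>j\<in>?I. \<Sum>k\<in>J. A k i * A k j * c i j)"
      by (subst sum.swap, rule sum.cong[OF refl], rule sum.swap)
    then have "Poly_Mapping.lookup ((\<Sum>i\<in>{p}. linear_form ?I (A i) ^ 2)
          - (\<Sum>i\<in>J. linear_form ?I (A i) ^ 2)) m
        = (\<Sum>i\<in>?I. \<Sum>j\<in>?I. (A p i * A p j - (\<Sum>k\<in>J. A k i * A k j)) * c i j)"
      by (simp only: lookup_minus lookup_sum lookup_linear_form_square c left_diff_distrib
            sum_subtractf sum_distrib_right sum.insert[OF finite.emptyI] sum.empty empty_iff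
            not_False_eq_True add_0_right)
    also have "\<dots> = (\<Sum>i\<in>?I. \<Sum>j\<in>?I. H i j * c i j)"
      by (intro sum.cong refl) (simp only: A(2))
    also have "\<dots> = Poly_Mapping.lookup h m"
      unfolding quadratic_expansion[OF finite.insertI[OF assms(1)] assms(3)] c
      by (intro sum.cong refl) (simp only: M H_def)
    finally show "Poly_Mapping.lookup h m = Poly_Mapping.lookup
        ((\<Sum>i\<in>{p}. linear_form ?I (A i) ^ 2) - (\<Sum>i\<in>J. linear_form ?I (A i) ^ 2)) m" ..
  qed
  then show ?thesis
    unfolding lorentzian_signature_def has_signature_def
    using A(1) assms(1,2) by (intro exI[of _ A] exI[of _ "{p}"] exI[of _ J]) auto
qed

definition normalized_poly :: "'v set \<Rightarrow> nat \<Rightarrow> (('v \<Rightarrow>\<^sub>0 nat) \<Rightarrow> real) \<Rightarrow> 'v rpoly" where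
  "normalized_poly I d a = (\<Sum>m\<in>monomials I d. Poly_Mapping.single m (a m / mfact I m))"

lemma lookup_normalized_poly:
  assumes "finite I"
  shows "Poly_Mapping.lookup (normalized_poly I d a) m
       = (if m \<in> monomials I d then a m / mfact I m else 0)"
  using finite_monomials[OF assms]
  by (simp add: normalized_poly_def lookup_sum lookup_single when_def)

text \<open>
  Strict Lorentzianity in terms of normalized coefficients: by the shift rule, the Hessian of
  the derivative along \<open>\<alpha>\<close> consists of the numbers \<open>a (\<alpha> + e\<^sub>i + e\<^sub>j)\<close>.
\<close>

lemma strictly_lorentzian_normalized_poly:
  assumes "finite J" "p \<notin> J"
    and pos: "\<And>m. m \<in> monomials (insert p J) d \<Longrightarrow> a m > 0"
    and neg: "\<And>e \<alpha>. e + 2 = d \<Longrightarrow> \<alpha> \<in> monomials (insert p J) e \<Longrightarrow>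
      positive_definite J (\<lambda>i j. - schur_complement p
        (\<lambda>i j. a (\<alpha> + unit_exp i + unit_exp j)) i j)"
  shows "strictly_lorentzian (insert p J) d (normalized_poly (insert p J) d a)"
proof -
  let ?I = "insert p J" let ?h = "normalized_poly ?I d a"
  have fin: "finite ?I" using assms(1) by simp
  note lookup = lookup_normalized_poly[OF fin, of d a]
  have hom: "homogeneous ?I d ?h"
    by (simp add: homogeneous_iff lookup)
  have "lorentzian_signature ?I (foldr partial is ?h)"
    if "is": "set is \<subseteq> ?I" "length is + 2 = d" for "is"
  proof -
    define \<alpha> :: "'a \<Rightarrow>\<^sub>0 nat" where "\<alpha> = (\<Sum>i\<leftarrow>is. unit_exp i)"
    have \<alpha>: "\<alpha> \<in> monomials ?I (length is)"
      unfolding \<alpha>_def by (rule sum_list_unit_exp_in_monomials[OF fin "is"(1)])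
    have mem: "\<alpha> + unit_exp i + unit_exp j \<in> monomials ?I d" if "i \<in> ?I" "j \<in> ?I" for i j
      using \<alpha> unfolding "is"(2)[symmetric] add_2_eq_Suc'
        add_unit_exp_in_monomials[OF fin that(1)] add_unit_exp_in_monomials[OF fin that(2)] .
    have "normalized_coeff ?I (foldr partial is ?h) (unit_exp i + unit_exp j)
        = a (\<alpha> + unit_exp i + unit_exp j)" if "i \<in> ?I" "j \<in> ?I" for i j
    proof -
      have "unit_exp i + unit_exp j + \<alpha> = \<alpha> + unit_exp i + unit_exp j"
        by (simp add: ac_simps)
      then show ?thesis
        unfolding normalized_coeff_foldr_partial[OF fin "is"(1)] \<alpha>_def[symmetric]
        using mem[OF that] mfact_pos[of ?I "\<alpha> + unit_exp i + unit_exp j"]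
        by (simp add: normalized_coeff_def lookup)
    qed
    then show ?thesis
      using lorentzian_signatureI[OF assms(1,2), of "foldr partial is ?h"
          "\<lambda>i j. a (\<alpha> + unit_exp i + unit_exp j)"]
        homogeneous_foldr_partial[OF fin "is"(1), of 2] hom "is"(2) pos mem neg[OF "is"(2) \<alpha>]
      by simp
  qed
  moreover have "Poly_Mapping.lookup ?h m > 0" if "m \<in> monomials ?I d" for m
    using that pos mfact_pos[of ?I m] by (simp add: lookup)
  ultimately show ?thesis
    unfolding strictly_lorentzian_def using fin hom by blast
qed

section \<open>Deforming a set function into a polynomial\<close>

text \<open>
  The factor \<open>b\<close> depends only on the support in \<open>J\<close>, so raising the exponent of a variable
  that is already present changes it as little as raising the exponent of a variable outside
  \<open>J\<close>. The power of \<open>\<delta>\<close> removes the monomials that are not squarefree in \<open>J\<close> as \<open>\<delta>\<close> tends to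
  \<open>0\<close>. Its exponent is quadratic, so in a Hessian it splits into a rescaling of rows and columns
  and one extra factor \<open>\<delta>\<close> on the diagonal.
\<close>

definition deformed_coeff :: "'v set \<Rightarrow> ('v set \<Rightarrow> real) \<Rightarrow> real \<Rightarrow> ('v \<Rightarrow>\<^sub>0 nat) \<Rightarrow> real" where
  "deformed_coeff J b \<delta> m =
     b (Poly_Mapping.keys m \<inter> J) * \<delta> ^ (\<Sum>i\<in>J. Poly_Mapping.lookup m i choose 2)"

text \<open>
  The negated Schur complement of the Hessian at a monomial with support \<open>T\<close> in \<open>J\<close>, up to a
  positive factor and a rescaling of the coordinates, with \<open>\<delta> = 0\<close> on the diagonal.
\<close>

definition gap_matrix :: "('v set \<Rightarrow> real) \<Rightarrow> 'v set \<Rightarrow> 'v \<Rightarrow> 'v \<Rightarrow> real" where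
  "gap_matrix b T i j =
     (if i = j then 1 else 1 - b T * b (insert i (insert j T)) / (b (insert i T) * b (insert j T)))"

lemma sum_choose_2_add_unit_exp:
  assumes "finite J" "i \<in> J"
  shows "(\<Sum>k\<in>J. Poly_Mapping.lookup (m + unit_exp i) k choose 2)
    = Poly_Mapping.lookup m i + (\<Sum>k\<in>J. Poly_Mapping.lookup m k choose 2)"
proof -
  have "(\<Sum>k\<in>J - {i}. Poly_Mapping.lookup (m + unit_exp i) k choose 2)
      = (\<Sum>k\<in>J - {i}. Poly_Mapping.lookup m k choose 2)"
    by (rule sum.cong) (auto simp: lookup_add lookup_unit_exp)
  moreover have "Suc x choose 2 = x + (x choose 2)" for x
    by (simp add: numeral_2_eq_2)
  ultimately show ?thesis
    by (simp add: sum.remove[OF assms] lookup_add lookup_unit_exp)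
qed

lemma deformed_coeff_add_unit_exp:
  assumes "finite J" "i \<in> J"
  shows "deformed_coeff J b \<delta> (m + unit_exp i)
    = b (insert i (Poly_Mapping.keys m \<inter> J)) * \<delta> ^ Poly_Mapping.lookup m i
      * \<delta> ^ (\<Sum>i\<in>J. Poly_Mapping.lookup m i choose 2)"
  unfolding deformed_coeff_def keys_add_unit_exp sum_choose_2_add_unit_exp[OF assms]
  using assms(2) by (simp add: power_add)

lemma deformed_coeff_add_unit_exp_outside:
  assumes "p \<notin> J"
  shows "deformed_coeff J b \<delta> (m + unit_exp p) = deformed_coeff J b \<delta> m"
proof -
  have "(\<Sum>k\<in>J. Poly_Mapping.lookup (m + unit_exp p) k choose 2)
      = (\<Sum>k\<in>J. Poly_Mapping.lookup m k choose 2)"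
    using assms by (intro sum.cong) (auto simp: lookup_add lookup_unit_exp)
  then show ?thesis
    using assms by (simp add: deformed_coeff_def keys_add_unit_exp)
qed

text \<open>
  The rescaling factor \<open>s i\<close> is the quotient of the entries at \<open>(p, i)\<close> and \<open>(p, p)\<close>, which
  turns the rank-one part of the Schur complement into the all-ones matrix.
\<close>

lemma deformed_coeff_schur_complement:
  assumes "finite J" "p \<notin> J" and b: "\<And>S. S \<subseteq> J \<Longrightarrow> b S > 0" and \<delta>: "\<delta> > 0"
    and T: "T = Poly_Mapping.keys \<alpha> \<inter> J"
    and ij: "i \<in> J" "j \<in> J"
  defines "s \<equiv> \<lambda>i. \<delta> ^ Poly_Mapping.lookup \<alpha> i * b (insert i T) / b T"
  shows "- schur_complement p (\<lambda>i j. deformed_coeff J b \<delta> (\<alpha> + unit_exp i + unit_exp j)) i j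
    = (\<delta> ^ (\<Sum>i\<in>J. Poly_Mapping.lookup \<alpha> i choose 2) * b T) *
      ((gap_matrix b T i j - (if i = j then \<delta> * b T / b (insert i T) else 0)) * s i * s j)"
proof -
  define X where "X = \<delta> ^ (\<Sum>i\<in>J. Poly_Mapping.lookup \<alpha> i choose 2)"
  have X: "X > 0" unfolding X_def using \<delta> by simp
  have "T \<subseteq> J" using T by auto
  then have pos: "b T > 0" "b (insert i T) > 0" "b (insert j T) > 0" using b ij by auto
  have pp: "deformed_coeff J b \<delta> (\<alpha> + unit_exp p + unit_exp p) = b T * X"
    by (simp only: deformed_coeff_add_unit_exp_outside[OF assms(2)]) (simp add: deformed_coeff_def T X_def)
  have pi: "deformed_coeff J b \<delta> (\<alpha> + unit_exp p + unit_exp k)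
      = b (insert k T) * \<delta> ^ Poly_Mapping.lookup \<alpha> k * X" if "k \<in> J" for k
  proof -
    have "\<alpha> + unit_exp p + unit_exp k = \<alpha> + unit_exp k + unit_exp p" by (simp add: ac_simps)
    then show ?thesis
      by (simp add: deformed_coeff_add_unit_exp_outside[OF assms(2)]
          deformed_coeff_add_unit_exp[OF assms(1) that] T X_def)
  qed
  have "\<delta> ^ (\<Sum>k\<in>J. Poly_Mapping.lookup (\<alpha> + unit_exp i) k choose 2)
      = \<delta> ^ Poly_Mapping.lookup \<alpha> i * X"
    by (simp add: sum_choose_2_add_unit_exp[OF assms(1) ij(1)] X_def power_add)
  then have ijc: "deformed_coeff J b \<delta> (\<alpha> + unit_exp i + unit_exp j)
      = b (insert i (insert j T)) * \<delta> ^ Poly_Mapping.lookup \<alpha> i * \<delta> ^ Poly_Mapping.lookup \<alpha> j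
        * (if i = j then \<delta> else 1) * X"
    using ij by (simp add: deformed_coeff_add_unit_exp[OF assms(1) ij(2)] keys_add_unit_exp T
        lookup_add lookup_unit_exp insert_commute power_add)
  show ?thesis
    unfolding schur_complement_def pp pi[OF ij(1)] pi[OF ij(2)] ijc X_def[symmetric]
    using pos X by (simp add: gap_matrix_def s_def field_simps)
qed

text \<open>
  For \<open>i \<in> T\<close> one has \<open>insert i T = T\<close>, so that \<open>gap_matrix b T i j\<close> vanishes for every
  \<open>j \<noteq> i\<close>. The form is therefore the direct sum of \<open>1 - \<delta>\<close> times a sum of squares on \<open>T\<close> and a
  form on \<open>J - T\<close> whose gap \<open>\<mu>\<close> absorbs the diagonal perturbation caused by \<open>\<delta>\<close>.
\<close>

lemma positive_definite_deformed_coeff: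
  assumes "finite J" "p \<notin> J" and b: "\<And>S. S \<subseteq> J \<Longrightarrow> b S > 0" and \<delta>: "0 < \<delta>" "\<delta> < 1"
    and T: "T = Poly_Mapping.keys \<alpha> \<inter> J"
    and gap: "\<And>z. \<mu> * (\<Sum>i\<in>J - T. (z i)\<^sup>2) \<le> qform (J - T) (gap_matrix b T) z"
    and small: "\<And>i. i \<in> J \<Longrightarrow> \<delta> * b T / b (insert i T) < \<mu>"
  shows "positive_definite J (\<lambda>i j. - schur_complement p
        (\<lambda>i j. deformed_coeff J b \<delta> (\<alpha> + unit_exp i + unit_exp j)) i j)"
  unfolding positive_definite_def
proof (intro allI impI)
  fix x :: "'a \<Rightarrow> real" assume x: "\<exists>i\<in>J. x i \<noteq> 0"
  have TJ: "T \<subseteq> J" using T by auto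
  have finT: "finite T" using TJ assms(1) finite_subset by blast
  have bT: "b T > 0" and bi: "\<And>i. i \<in> J \<Longrightarrow> b (insert i T) > 0" using b TJ by auto
  define s where "s i = \<delta> ^ Poly_Mapping.lookup \<alpha> i * b (insert i T) / b T" for i
  define t where "t i = \<delta> * b T / b (insert i T)" for i
  define z where "z i = s i * x i" for i
  define N where "N i j = gap_matrix b T i j - (if i = j then t i else 0)" for i j
  have z: "\<exists>i\<in>J. z i \<noteq> 0"
    using x bT bi \<delta>(1) unfolding z_def s_def by (metis divide_pos_pos less_numeral_extra(3)
        mult_eq_0_iff mult_pos_pos zero_less_power)
  have "0 < (\<Sum>i\<in>J. (if i \<in> T then 1 - \<delta> else \<mu> - t i) * (z i)\<^sup>2)"
  proof -
    have c: "(if i \<in> T then 1 - \<delta> else \<mu> - t i) > 0" if "i \<in> J" for i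
      using \<delta>(2) small[OF that] by (auto simp: t_def)
    from z obtain k where "k \<in> J" "z k \<noteq> 0" by blast
    then show ?thesis
      using c by (intro sum_pos2[OF assms(1), of k] mult_pos_pos mult_nonneg_nonneg) (auto simp: less_imp_le)
  qed
  also have "\<dots> = (\<Sum>i\<in>T. (1 - \<delta>) * (z i)\<^sup>2) + (\<Sum>i\<in>J - T. (\<mu> - t i) * (z i)\<^sup>2)"
    by (subst sum.subset_diff[OF TJ assms(1)]) (simp add: add.commute)
  also have "(\<Sum>i\<in>T. (1 - \<delta>) * (z i)\<^sup>2) = qform T N z"
  proof -
    have "N i j = (if i = j then 1 - \<delta> else 0)" if "i \<in> T" "j \<in> T" for i j
      using that bT by (simp add: N_def gap_matrix_def t_def insert_absorb)
    then have "qform T N z = qform T (\<lambda>i j. if i = j then 1 - \<delta> else 0) z"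
      by (rule qform_cong)
    then show ?thesis by (simp add: qform_diagonal[OF finT])
  qed
  also have "(\<Sum>i\<in>J - T. (\<mu> - t i) * (z i)\<^sup>2) \<le> qform (J - T) N z"
    using gap[of z] assms(1)
    by (simp add: N_def[abs_def] qform_diff qform_diagonal left_diff_distrib sum_subtractf sum_distrib_left)
  also have "qform T N z + qform (J - T) N z = qform (T \<union> (J - T)) N z"
  proof (rule qform_union_disjoint[symmetric])
    fix i j assume i: "i \<in> T" and j: "j \<in> J - T"
    then have "b (insert j T) > 0" using bi by blast
    with i j bT show "N i j = 0" "N j i = 0"
      by (auto simp: N_def gap_matrix_def insert_absorb insert_commute)
  qed (use assms(1) finT in auto)
  also have "T \<union> (J - T) = J" using TJ by auto
  finally have "0 < (\<delta> ^ (\<Sum>i\<in>J. Poly_Mapping.lookup \<alpha> i choose 2) * b T) * qform J N z"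
    using \<delta>(1) bT by simp
  also have "\<dots> = qform J (\<lambda>i j. - schur_complement p
        (\<lambda>i j. deformed_coeff J b \<delta> (\<alpha> + unit_exp i + unit_exp j)) i j) x"
    unfolding z_def qform_scale[symmetric]
    by (rule qform_cong)
       (simp add: deformed_coeff_schur_complement[OF assms(1,2) b \<delta>(1) T] N_def t_def s_def)
  finally show "0 < qform J (\<lambda>i j. - schur_complement p
        (\<lambda>i j. deformed_coeff J b \<delta> (\<alpha> + unit_exp i + unit_exp j)) i j) x" .
qed

text \<open>
  The upper bounds on \<open>\<delta>\<close> depend on the monomial \<open>\<alpha>\<close> only through its support \<open>T\<close> in \<open>J\<close>, and
  there are finitely many such \<open>T\<close>. As \<open>\<alpha>\<close> has degree \<open>d - 2\<close>, its support has at
  most \<open>d - 2\<close> elements, so the gap is asked for these \<open>T\<close> only.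
\<close>

lemma eventually_strictly_lorentzian_deformed:
  assumes "finite J" "p \<notin> J" and b: "\<And>S. S \<subseteq> J \<Longrightarrow> b S > 0"
    and "\<mu> > 0"
    and gap: "\<And>T z. T \<subseteq> J \<Longrightarrow> card T + 2 \<le> d \<Longrightarrow>
        \<mu> * (\<Sum>i\<in>J - T. (z i)\<^sup>2) \<le> qform (J - T) (gap_matrix b T) z"
  shows "\<forall>\<^sub>F \<delta> in at_right 0.
    strictly_lorentzian (insert p J) d (normalized_poly (insert p J) d (deformed_coeff J b \<delta>))"
proof -
  have lim: "\<forall>\<^sub>F \<delta> in at_right 0. \<delta> * c < \<mu>" for c :: real
  proof -
    have "((\<lambda>\<delta>. \<delta> * c) \<longlongrightarrow> 0 * c) (at_right 0)" by (intro tendsto_intros)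
    then show ?thesis using \<open>\<mu> > 0\<close> by (intro order_tendstoD(2)[of _ "0 * c"]) auto
  qed
  have "\<forall>\<^sub>F \<delta> in at_right 0. \<forall>T\<in>Pow J. \<forall>i\<in>J. \<delta> * (b T / b (insert i T)) < \<mu>"
    using assms(1) by (intro eventually_ball_finite ballI lim) auto
  moreover have "\<forall>\<^sub>F \<delta> in at_right (0::real). 0 < \<delta> \<and> \<delta> < 1"
    unfolding eventually_at_right_field by (intro exI[of _ 1]) simp
  ultimately show ?thesis
  proof eventually_elim
    case (elim \<delta>)
    show ?case
    proof (rule strictly_lorentzian_normalized_poly[OF assms(1,2)])
      fix m show "deformed_coeff J b \<delta> m > 0"
        using b elim(2) by (simp add: deformed_coeff_def)
    next
      fix e \<alpha> assume e: "e + 2 = d" and \<alpha>: "\<alpha> \<in> monomials (insert p J) e"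
      define T where "T = Poly_Mapping.keys \<alpha> \<inter> J"
      have "card T \<le> (\<Sum>i\<in>T. Poly_Mapping.lookup \<alpha> i)"
        unfolding card_eq_sum by (rule sum_mono) (auto simp: T_def in_keys_iff Suc_le_eq)
      also have "\<dots> \<le> (\<Sum>i\<in>insert p J. Poly_Mapping.lookup \<alpha> i)"
        using assms(1) by (intro sum_mono2) (auto simp: T_def)
      also have "\<dots> = e" using \<alpha> assms(1) by (simp add: monomials_iff)
      finally have "card T + 2 \<le> d" using e by simp
      moreover have "T \<subseteq> J" by (auto simp: T_def)
      ultimately show "positive_definite J (\<lambda>i j. - schur_complement p
          (\<lambda>i j. deformed_coeff J b \<delta> (\<alpha> + unit_exp i + unit_exp j)) i j)"
        using elim gap
        by (intro positive_definite_deformed_coeff[OF assms(1,2) b _ _ T_def, where \<mu> = \<mu>]) auto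
    qed
  qed
qed

section \<open>Parallel elements, contractions and quotients\<close>

context matroid
begin

lemma rk_singleton_le: "i \<in> E \<Longrightarrow> rk {i} \<le> 1"
  using rk_le_card[of "{i}"] by simp

lemma rk_pair_le: "i \<in> E \<Longrightarrow> j \<in> E \<Longrightarrow> rk {i, j} \<le> rk {i} + rk {j}"
  using rk_submodular[of "{i}" "{j}"] by (simp add: insert_commute)

lemma rk_singleton_le_pair: "i \<in> E \<Longrightarrow> j \<in> E \<Longrightarrow> rk {i} \<le> rk {i, j}"
  by (rule rk_mono) auto

lemma parallel_trans:
  assumes "i \<in> E" "j \<in> E" "k \<in> E" "rk {j} = 1" "rk {i, j} \<le> 1" "rk {j, k} \<le> 1"
  shows "rk {i, k} \<le> 1"
proof -
  have "rk {j} \<le> rk ({i, j} \<inter> {j, k})" by (rule rk_mono) (use assms in auto)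
  moreover have "rk {i, k} \<le> rk ({i, j} \<union> {j, k})" by (rule rk_mono) (use assms in auto)
  moreover have "rk ({i, j} \<union> {j, k}) + rk ({i, j} \<inter> {j, k}) \<le> rk {i, j} + rk {j, k}"
    by (rule rk_submodular) (use assms in auto)
  ultimately show ?thesis using assms(4-6) by linarith
qed

definition parallel_class :: "'a \<Rightarrow> 'a set" where
  "parallel_class i = {j \<in> E. rk {i, j} \<le> 1}"

lemma parallel_class_eq_iff:
  assumes "i \<in> E" "j \<in> E" "rk {i} \<noteq> 0" "rk {j} \<noteq> 0"
  shows "parallel_class i = parallel_class j \<longleftrightarrow> rk {i, j} \<le> 1"
proof
  assume eq: "parallel_class i = parallel_class j"
  have "j \<in> parallel_class j"
    using rk_singleton_le[OF assms(2)] assms(2) by (simp add: parallel_class_def)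
  then have "j \<in> parallel_class i" by (simp only: eq)
  then show "rk {i, j} \<le> 1" by (simp add: parallel_class_def)
next
  assume ij: "rk {i, j} \<le> 1"
  have "rk {i} = 1" "rk {j} = 1"
    using assms(3,4) rk_singleton_le[OF assms(1)] rk_singleton_le[OF assms(2)] by linarith+
  moreover have "{j, i} = {i, j}" by blast
  ultimately have "rk {i, k} \<le> 1 \<longleftrightarrow> rk {j, k} \<le> 1" if "k \<in> E" for k
    using parallel_trans[OF assms(1,2) that] parallel_trans[OF assms(2,1) that] ij by metis
  then show "parallel_class i = parallel_class j"
    unfolding parallel_class_def by blast
qed

lemma contraction:
  assumes "T \<subseteq> E"
  shows "matroid (E - T) (\<lambda>S. rk (S \<union> T) - rk T)"
proof
  have ge: "rk T \<le> rk (S \<union> T)" if "S \<subseteq> E - T" for S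
    by (rule rk_mono) (use that assms in auto)
  show "finite (E - T)" using finite_ground by simp
  show "rk (S \<union> T) - rk T \<le> card S" if "S \<subseteq> E - T" for S
  proof -
    have "rk (S \<union> T) + rk (S \<inter> T) \<le> rk S + rk T"
      by (rule rk_submodular) (use that assms in auto)
    moreover have "rk S \<le> card S" by (rule rk_le_card) (use that in auto)
    ultimately show ?thesis by linarith
  qed
  show "rk (S \<union> T) - rk T \<le> rk (S' \<union> T) - rk T" if "S \<subseteq> S'" "S' \<subseteq> E - T" for S S'
    by (intro diff_le_mono rk_mono) (use that assms in auto)
  show "rk (S \<union> S' \<union> T) - rk T + (rk (S \<inter> S' \<union> T) - rk T)
      \<le> rk (S \<union> T) - rk T + (rk (S' \<union> T) - rk T)" if "S \<subseteq> E - T" "S' \<subseteq> E - T" for S S'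
  proof -
    have "rk ((S \<union> T) \<union> (S' \<union> T)) + rk ((S \<union> T) \<inter> (S' \<union> T)) \<le> rk (S \<union> T) + rk (S' \<union> T)"
      by (rule rk_submodular) (use that assms in auto)
    moreover have "(S \<union> T) \<union> (S' \<union> T) = S \<union> S' \<union> T" "(S \<union> T) \<inter> (S' \<union> T) = S \<inter> S' \<union> T"
      by auto
    moreover have "rk T \<le> rk (S \<inter> S' \<union> T)" "rk T \<le> rk (S \<union> S' \<union> T)"
      by (rule ge; use that in auto)+
    ultimately show ?thesis using ge[OF that(1)] ge[OF that(2)] by simp
  qed
qed

end

lemma flag_matroid_matroid: "flag_matroid E l rk \<Longrightarrow> k \<in> {1..l} \<Longrightarrow> matroid E (rk k)"
  by (simp add: flag_matroid_def)

lemma flag_matroid_quotient: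
  assumes "flag_matroid E l rk" "1 \<le> r" "r \<le> k" "k \<le> l"
  shows "matroid_quotient E (rk r) (rk k)"
  using assms(3,4)
proof (induction rule: dec_induct)
  case base
  show ?case by (simp add: matroid_quotient_def)
next
  case (step m)
  then have "matroid_quotient E (rk m) (rk (m + 1))"
    using assms(1,2) by (auto simp: flag_matroid_def)
  moreover have "matroid_quotient E (rk r) (rk m)" using step by simp
  ultimately show ?case
    unfolding matroid_quotient_def by (metis Suc_eq_plus1 order_trans)
qed

text \<open>
  Contracting \<open>T\<close> subtracts \<open>rk T\<close> from every rank, and these constants cancel in the
  differences that define quotients.
\<close>

lemma flag_matroid_contraction:
  assumes "flag_matroid E l rk" "T \<subseteq> E"
  shows "flag_matroid (E - T) l (\<lambda>k S. rk k (S \<union> T) - rk k T)"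
  unfolding flag_matroid_def
proof (intro conjI ballI allI impI)
  fix k assume "k \<in> {1..l}"
  then show "matroid (E - T) (\<lambda>S. rk k (S \<union> T) - rk k T)"
    using matroid.contraction[OF flag_matroid_matroid[OF assms(1)] assms(2)] by blast
next
  fix k assume k: "0 < k \<and> k < l"
  then have q: "matroid_quotient E (rk k) (rk (k + 1))"
    and M: "matroid E (rk k)" "matroid E (rk (k + 1))"
    using assms(1) by (auto simp: flag_matroid_def)
  show "matroid_quotient (E - T) (\<lambda>S. rk k (S \<union> T) - rk k T) (\<lambda>S. rk (k + 1) (S \<union> T) - rk (k + 1) T)"
    unfolding matroid_quotient_def
  proof (intro allI impI)
    fix S S' assume S: "S \<subseteq> S' \<and> S' \<subseteq> E - T"
    have ge: "rk' T \<le> rk' (S \<union> T)" "rk' T \<le> rk' (S' \<union> T)" if "matroid E rk'" for rk'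
      by (rule matroid.rk_mono[OF that]; use S assms(2) in auto)+
    have "int (rk k (S' \<union> T)) - int (rk k (S \<union> T)) \<le> int (rk (k + 1) (S' \<union> T)) - int (rk (k + 1) (S \<union> T))"
      using q S assms(2) unfolding matroid_quotient_def by (elim allE impE) auto
    then show "int (rk k (S' \<union> T) - rk k T) - int (rk k (S \<union> T) - rk k T)
        \<le> int (rk (k + 1) (S' \<union> T) - rk (k + 1) T) - int (rk (k + 1) (S \<union> T) - rk (k + 1) T)"
      using ge[OF M(1)] ge[OF M(2)] by (simp add: of_nat_diff)
  qed
qed

section \<open>The quadratic form of a flag matroid\<close>

text \<open>
  In terms of weights \<open>c(S)\<close> as in the Tutte polynomial, the entry at \<open>i \<noteq> j\<close> is
  \<open>1 - c(\<emptyset>) c({i, j}) / (c({i}) c({j}))\<close>, for the matroids with index in \<open>R\<close>.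
\<close>

definition flag_kernel :: "(nat \<Rightarrow> 'a set \<Rightarrow> nat) \<Rightarrow> (nat \<Rightarrow> real) \<Rightarrow> nat set \<Rightarrow> 'a \<Rightarrow> 'a \<Rightarrow> real" where
  "flag_kernel rk q R i j =
     (if i = j then 1 else 1 - (\<Prod>k\<in>R. q k ^ (rk k {i} + rk k {j} - rk k {i, j})))"

text \<open>
  If \<open>j\<close> raises the rank over \<open>i\<close> in one matroid of the flag, then it does so in every later
  one, because rank differences grow along the flag. There the exponent in \<open>flag_kernel\<close> is \<open>0\<close>.
\<close>

lemma flag_rk_pair_eq:
  assumes flag: "flag_matroid E l rk" and "1 \<le> r" "r \<le> k" "k \<le> l" "i \<in> E" "j \<in> E"
    and "rk r {i} < rk r {i, j}"
  shows "rk k {i} + rk k {j} - rk k {i, j} = 0"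
proof -
  have "matroid E (rk k)" using assms by (intro flag_matroid_matroid[OF flag]) simp
  then have "rk k {j} \<le> 1" using assms(6) by (rule matroid.rk_singleton_le)
  moreover have "int (rk r {i, j}) - int (rk r {i}) \<le> int (rk k {i, j}) - int (rk k {i})"
    using flag_matroid_quotient[OF assms(1-4)] assms(5,6)
    unfolding matroid_quotient_def by (elim allE[of _ "{i}"] allE[of _ "{i, j}"] impE) auto
  ultimately show ?thesis using assms(7) by linarith
qed

text \<open>
  This is \<open>(x + y)\<^sup>2 / (a + b) \<le> x\<^sup>2 / a + y\<^sup>2 / b\<close> in a form that also covers \<open>a = 0\<close> and \<open>b = 0\<close>.
  The mixed term is bounded by the inequality of the arithmetic and geometric means.
\<close>

lemma square_add_le:
  fixes x y a b P Q :: real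
  assumes "x\<^sup>2 \<le> a * P" "y\<^sup>2 \<le> b * Q" "0 \<le> a" "0 \<le> b" "0 \<le> P" "0 \<le> Q"
  shows "(x + y)\<^sup>2 \<le> (a + b) * (P + Q)"
proof -
  have "(x * y)\<^sup>2 \<le> (a * P) * (b * Q)"
    using assms by (simp add: power_mult_distrib mult_mono)
  also have "\<dots> = (a * Q) * (b * P)" by simp
  also have "\<dots> \<le> ((a * Q + b * P) / 2)\<^sup>2"
    using zero_le_power2[of "a * Q - b * P"] by (simp add: power2_eq_square algebra_simps)
  finally have "(x * y)\<^sup>2 \<le> ((a * Q + b * P) / 2)\<^sup>2" .
  moreover have "0 \<le> (a * Q + b * P) / 2" using assms(3-6) by simp
  ultimately have "x * y \<le> (a * Q + b * P) / 2" by (rule power2_le_imp_le)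
  then have "2 * (x * y) \<le> a * Q + b * P" by simp
  then have "x\<^sup>2 + y\<^sup>2 + 2 * (x * y) \<le> a * P + b * Q + (a * Q + b * P)"
    using assms(1,2) by (intro add_mono)
  then show ?thesis by (simp add: power2_sum algebra_simps)
qed

text \<open>
  Downward induction on \<open>r\<close>, which adds the matroid with index \<open>n\<close> below the matroids with
  indices \<open>Suc n, \<dots>, l\<close>. For \<open>r = Suc l\<close> the kernel is the identity matrix and the bounds are the
  Cauchy-Schwarz inequality and an equality. The bounds are stated for all \<open>A\<close> because the step
  applies them to the loops and to the nonloops in \<open>A\<close> separately.
\<close>

lemma flag_kernel_bounds:
  assumes flag: "flag_matroid E l rk"
    and q: "\<And>k. k \<in> {1..l} \<Longrightarrow> 0 < q k \<and> q k \<le> 1"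
    and "1 \<le> r" "r \<le> Suc l" "A \<subseteq> E" "finite A"
  shows "(\<Sum>i\<in>A. z i)\<^sup>2 \<le> real (card A) * qform A (flag_kernel rk q {r..l}) z"
    and "(\<Prod>k\<in>{r..l}. q k) * (\<Sum>i\<in>A. (z i)\<^sup>2) \<le> qform A (flag_kernel rk q {r..l}) z"
proof -
  let ?Q = "\<lambda>r A. qform A (flag_kernel rk q {r..l}) z"
  have "(\<Sum>i\<in>A. z i)\<^sup>2 \<le> real (card A) * ?Q r A \<and> (\<Prod>k\<in>{r..l}. q k) * (\<Sum>i\<in>A. (z i)\<^sup>2) \<le> ?Q r A"
    using assms(4,5,6)
  proof (induction arbitrary: A rule: inc_induct)
    case base
    have "qform A (flag_kernel rk q {Suc l..l}) z = qform A (\<lambda>i j. if i = j then 1 else 0) z"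
      by (rule qform_cong) (simp add: flag_kernel_def)
    also have "\<dots> = (\<Sum>i\<in>A. (z i)\<^sup>2)" using base.prems by (simp add: qform_diagonal)
    finally show ?case using sum_squared_le_card[OF base.prems(2), of z] by simp
  next
    case (step n)
    have n: "1 \<le> n" "n \<le> l" "n \<in> {1..l}" using step.hyps assms(3) by auto
    interpret matroid E "rk n" by (rule flag_matroid_matroid[OF flag n(3)])
    have qn: "0 < q n" "q n \<le> 1" using q[OF n(3)] by auto
    define \<rho> where "\<rho> = (\<Prod>k\<in>{Suc n..l}. q k)"
    have \<rho>: "\<rho> \<ge> 0" unfolding \<rho>_def
      by (rule prod_nonneg) (use q n in \<open>force intro: less_imp_le\<close>)
    have range: "{n..l} = insert n {Suc n..l}" using n by auto
    define L where "L = {i \<in> A. rk n {i} = 0}"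
    define N where "N = {i \<in> A. rk n {i} \<noteq> 0}"
    have LN: "A = L \<union> N" "L \<inter> N = {}" "L \<subseteq> E" "N \<subseteq> E" "finite L" "finite N"
      using step.prems by (auto simp: L_def N_def)
    note IH_L = step.IH[OF LN(3,5)] and IH_N = step.IH[OF LN(4,6)]
    have nonneg: "0 \<le> ?Q (Suc n) L" "0 \<le> ?Q (Suc n) N"
      using IH_L IH_N \<rho> unfolding \<rho>_def[symmetric]
      by (meson mult_nonneg_nonneg order_trans sum_nonneg zero_le_power2)+
    have zero: "flag_kernel rk q {n..l} i j = 0" if "i \<in> E" "j \<in> E" "rk n {i} < rk n {i, j}" for i j
    proof -
      have "i \<noteq> j" using that(3) by auto
      then show ?thesis
        using flag_rk_pair_eq[OF flag n(1) _ _ that] by (simp add: flag_kernel_def)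
    qed
    have sym: "flag_kernel rk q {n..l} i j = flag_kernel rk q {n..l} j i" for i j
      by (simp add: flag_kernel_def insert_commute add.commute)
    \<comment> \<open>A nonloop raises the rank over a loop, so loops and nonloops do not interact.\<close>
    have cross: "flag_kernel rk q {n..l} i j = 0" if "i \<in> L" "j \<in> N" for i j
    proof -
      have ij: "i \<in> E" "j \<in> E" "rk n {i} = 0" "rk n {j} \<noteq> 0"
        using that step.prems(1) by (auto simp: L_def N_def)
      have "rk n {j} \<le> rk n {i, j}" by (rule rk_mono) (use ij in auto)
      then show ?thesis using ij by (intro zero) auto
    qed
    have split: "?Q n A = ?Q n L + ?Q n N"
      unfolding LN(1) by (rule qform_union_disjoint) (use LN cross sym in auto)
    have "?Q n L = ?Q (Suc n) L"
    proof (rule qform_cong)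
      fix i j assume "i \<in> L" "j \<in> L"
      then show "flag_kernel rk q {n..l} i j = flag_kernel rk q {Suc n..l} i j"
        by (simp add: flag_kernel_def range L_def)
    qed
    \<comment> \<open>On nonloops the kernel is a convex combination of the previous one and the parallelism relation.\<close>
    define P where "P = qform N (\<lambda>i j. if parallel_class i = parallel_class j then 1 else 0) z"
    have "?Q n N = qform N (\<lambda>i j. q n * flag_kernel rk q {Suc n..l} i j
        + (1 - q n) * (if parallel_class i = parallel_class j then 1 else 0)) z"
    proof (rule qform_cong)
      fix i j assume ij: "i \<in> N" "j \<in> N"
      then have E: "i \<in> E" "j \<in> E" and nz: "rk n {i} \<noteq> 0" "rk n {j} \<noteq> 0"
        using step.prems(1) by (auto simp: N_def)
      have one: "rk n {i} = 1" "rk n {j} = 1"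
        using nz rk_singleton_le[OF E(1)] rk_singleton_le[OF E(2)] by linarith+
      show "flag_kernel rk q {n..l} i j = q n * flag_kernel rk q {Suc n..l} i j
        + (1 - q n) * (if parallel_class i = parallel_class j then 1 else 0)"
      proof (cases "rk n {i, j} \<le> 1")
        case True
        then have "rk n {i, j} = 1" using rk_singleton_le_pair[OF E] one by linarith
        then show ?thesis
          using True one
          by (simp add: parallel_class_eq_iff[OF E nz] flag_kernel_def range algebra_simps)
      next
        case False
        \<comment> \<open>Elements that are not parallel here are independent in all later matroids as well.\<close>
        then have "rk n {i} < rk n {i, j}" using one by simp
        moreover from this have "i \<noteq> j" by auto
        moreover have "flag_kernel rk q {Suc n..l} i j = 0"
          using flag_rk_pair_eq[OF flag n(1) _ _ E \<open>rk n {i} < rk n {i, j}\<close>] \<open>i \<noteq> j\<close>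
          by (simp add: flag_kernel_def)
        ultimately show ?thesis
          using False zero[OF E] by (simp add: parallel_class_eq_iff[OF E nz])
      qed
    qed
    then have QN: "?Q n N = q n * ?Q (Suc n) N + (1 - q n) * P"
      by (simp add: qform_add qform_mult P_def)
    have P: "(\<Sum>i\<in>N. z i)\<^sup>2 \<le> real (card N) * P" "0 \<le> P"
      unfolding P_def using qform_same_class_bounds[OF LN(6)] by blast+
    have QN0: "0 \<le> ?Q n N" using QN P(2) nonneg(2) qn by simp
    have "(\<Sum>i\<in>N. z i)\<^sup>2 = q n * (\<Sum>i\<in>N. z i)\<^sup>2 + (1 - q n) * (\<Sum>i\<in>N. z i)\<^sup>2"
      by (simp add: algebra_simps)
    also have "\<dots> \<le> q n * (real (card N) * ?Q (Suc n) N) + (1 - q n) * (real (card N) * P)"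
      using P(1) IH_N qn by (intro add_mono mult_left_mono) auto
    also have "\<dots> = real (card N) * ?Q n N"
      by (simp add: QN algebra_simps)
    finally have N1: "(\<Sum>i\<in>N. z i)\<^sup>2 \<le> real (card N) * ?Q n N" .
    have "(\<Sum>i\<in>A. z i)\<^sup>2 = ((\<Sum>i\<in>L. z i) + (\<Sum>i\<in>N. z i))\<^sup>2"
      using LN by (simp add: sum.union_disjoint)
    also have "\<dots> \<le> (real (card L) + real (card N)) * (?Q n L + ?Q n N)"
      using IH_L N1 nonneg(1) QN0 \<open>?Q n L = ?Q (Suc n) L\<close> by (intro square_add_le) auto
    also have "\<dots> = real (card A) * ?Q n A"
      unfolding split using LN by (simp add: card_Un_disjoint)
    finally have 1: "(\<Sum>i\<in>A. z i)\<^sup>2 \<le> real (card A) * ?Q n A" .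
    have "q n * (\<rho> * (\<Sum>i\<in>L. (z i)\<^sup>2)) \<le> 1 * (\<rho> * (\<Sum>i\<in>L. (z i)\<^sup>2))"
      using qn \<rho> by (intro mult_right_mono mult_nonneg_nonneg sum_nonneg) auto
    also have "\<dots> \<le> ?Q n L" using IH_L \<open>?Q n L = ?Q (Suc n) L\<close> by (simp add: \<rho>_def)
    finally have "q n * (\<rho> * (\<Sum>i\<in>L. (z i)\<^sup>2)) \<le> ?Q n L" .
    moreover have "q n * (\<rho> * (\<Sum>i\<in>N. (z i)\<^sup>2)) \<le> ?Q n N"
    proof -
      have "q n * (\<rho> * (\<Sum>i\<in>N. (z i)\<^sup>2)) \<le> q n * ?Q (Suc n) N"
        using IH_N qn by (intro mult_left_mono) (auto simp: \<rho>_def)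
      also have "\<dots> \<le> ?Q n N" using QN P(2) qn by simp
      finally show ?thesis .
    qed
    moreover have "(\<Prod>k\<in>{n..l}. q k) * (\<Sum>i\<in>A. (z i)\<^sup>2)
        = q n * (\<rho> * (\<Sum>i\<in>L. (z i)\<^sup>2)) + q n * (\<rho> * (\<Sum>i\<in>N. (z i)\<^sup>2))"
      using LN by (simp add: range \<rho>_def sum.union_disjoint algebra_simps)
    ultimately have "(\<Prod>k\<in>{n..l}. q k) * (\<Sum>i\<in>A. (z i)\<^sup>2) \<le> ?Q n A"
      unfolding split by linarith
    with 1 show ?case ..
  qed
  then show "(\<Sum>i\<in>A. z i)\<^sup>2 \<le> real (card A) * ?Q r A"
    "(\<Prod>k\<in>{r..l}. q k) * (\<Sum>i\<in>A. (z i)\<^sup>2) \<le> ?Q r A" by blast+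
qed

section \<open>Deformed Tutte polynomials\<close>

definition tutte_weight :: "nat \<Rightarrow> (nat \<Rightarrow> real) \<Rightarrow> (nat \<Rightarrow> 'a set \<Rightarrow> nat) \<Rightarrow> 'a set \<Rightarrow> real" where
  "tutte_weight l q rk S = (\<Prod>k\<in>{1..l}. q k powi (- int (rk k S)))"

text \<open>
  For \<open>\<kappa> = 1\<close> this is the normalized coefficient of the monomial of \<open>S\<close> in the Tutte
  polynomial: \<open>w\<^sub>0\<close> has exponent \<open>n - card S\<close> and all other exponents are at most \<open>1\<close>. The second
  difference of \<open>card S choose 2\<close> is \<open>1\<close>, so \<open>\<kappa> < 1\<close> contributes one factor \<open>\<kappa>\<close> to each ratio
  in \<open>gap_matrix\<close>.
\<close>

definition tutte_support_coeff ::
    "nat \<Rightarrow> nat \<Rightarrow> (nat \<Rightarrow> real) \<Rightarrow> (nat \<Rightarrow> 'a set \<Rightarrow> nat) \<Rightarrow> real \<Rightarrow> 'a set \<Rightarrow> real" where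
  "tutte_support_coeff n l q rk \<kappa> S
     = fact (n - card S) * \<kappa> ^ (card S choose 2) * tutte_weight l q rk S"

lemma tutte_weight_pos:
  assumes "\<And>k. k \<in> {1..l} \<Longrightarrow> 0 < q k \<and> q k \<le> 1"
  shows "tutte_weight l q rk S > 0"
  unfolding tutte_weight_def using assms by (intro prod_pos) (auto intro: zero_less_power_int)

text \<open>
  For each matroid the two sides have the same exponent of \<open>q\<^sub>k\<close>: the rank of \<open>T\<close> cancels when
  the ranks in the contraction by \<open>T\<close> are written out. Submodularity of the contraction keeps
  the natural subtraction in \<open>flag_kernel\<close> from truncating.
\<close>

lemma tutte_weight_ratio:
  assumes flag: "flag_matroid E l rk"
    and q: "\<And>k. k \<in> {1..l} \<Longrightarrow> 0 < q k \<and> q k \<le> 1"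
    and "T \<subseteq> E" "i \<in> E - T" "j \<in> E - T" "i \<noteq> j"
  defines "rk' \<equiv> \<lambda>k S. rk k (S \<union> T) - rk k T"
  shows "tutte_weight l q rk T * tutte_weight l q rk (insert i (insert j T))
    = tutte_weight l q rk (insert i T) * tutte_weight l q rk (insert j T)
      * (1 - flag_kernel rk' q {1..l} i j)"
proof -
  have "q k powi (- int (rk k T)) * q k powi (- int (rk k (insert i (insert j T))))
     = q k powi (- int (rk k (insert i T))) * q k powi (- int (rk k (insert j T)))
      * q k ^ (rk' k {i} + rk' k {j} - rk' k {i, j})" if k: "k \<in> {1..l}" for k
  proof -
    have "q k \<noteq> 0" using q[OF k] by simp
    interpret M: matroid E "rk k" by (rule flag_matroid_matroid[OF flag k])
    interpret C: matroid "E - T" "rk' k"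
      unfolding rk'_def by (rule M.contraction[OF assms(3)])
    have ge: "rk k T \<le> rk k (insert i T)" "rk k T \<le> rk k (insert j T)"
      "rk k T \<le> rk k (insert i (insert j T))"
      by (rule M.rk_mono; use assms(3-5) in auto)+
    have rk': "rk' k {i} = rk k (insert i T) - rk k T" "rk' k {j} = rk k (insert j T) - rk k T"
      "rk' k {i, j} = rk k (insert i (insert j T)) - rk k T"
      by (simp_all add: rk'_def)
    have "rk' k {i, j} \<le> rk' k {i} + rk' k {j}" by (rule C.rk_pair_le[OF assms(4,5)])
    then have "int (rk' k {i} + rk' k {j} - rk' k {i, j})
        = int (rk k (insert i T)) + int (rk k (insert j T))
          - int (rk k T) - int (rk k (insert i (insert j T)))"
      using ge unfolding rk' by linarith
    moreover have "- int (rk k T) + - int (rk k (insert i (insert j T)))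
        = - int (rk k (insert i T)) + - int (rk k (insert j T))
          + (int (rk k (insert i T)) + int (rk k (insert j T))
          - int (rk k T) - int (rk k (insert i (insert j T))))"
      by simp
    ultimately show ?thesis
      using \<open>q k \<noteq> 0\<close> by (metis power_int_add power_int_of_nat)
  qed
  then show ?thesis
    using assms(6) by (simp add: tutte_weight_def flag_kernel_def flip: prod.distrib)
qed

lemma tutte_gap_matrix:
  assumes flag: "flag_matroid E l rk"
    and q: "\<And>k. k \<in> {1..l} \<Longrightarrow> 0 < q k \<and> q k \<le> 1"
    and "finite E" "T \<subseteq> E" "card T + 2 \<le> card E" "0 < \<kappa>" "i \<in> E - T" "j \<in> E - T"
  defines "rk' \<equiv> \<lambda>k S. rk k (S \<union> T) - rk k T" and "N \<equiv> real (card (E - T))"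
  shows "gap_matrix (tutte_support_coeff (card E) l q rk \<kappa>) T i j
    = 1 - \<kappa> * N / (N - 1) * (1 - flag_kernel rk' q {1..l} i j)"
proof (cases "i = j")
  case True
  then show ?thesis by (simp add: gap_matrix_def flag_kernel_def)
next
  case False
  have finT: "finite T" using assms(3,4) finite_subset by blast
  define t r where "t = card T" and "r = card E - card T - 2"
  have cards: "card (insert i T) = t + 1" "card (insert j T) = t + 1"
    "card (insert i (insert j T)) = t + 2" "card E = t + r + 2"
    using finT assms(5,7,8) False by (auto simp: t_def r_def)
  have N: "N = real (r + 2)"
    using assms(4,5) finT by (simp add: N_def card_Diff_subset r_def)
  define w where "w = tutte_weight l q rk"
  have w: "w S > 0" for S unfolding w_def by (rule tutte_weight_pos[OF q])
  have ratio: "w T * w (insert i (insert j T)) = w (insert i T) * w (insert j T)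
      * (1 - flag_kernel rk' q {1..l} i j)"
    unfolding w_def rk'_def by (rule tutte_weight_ratio[OF flag q assms(4,7,8) False])
  have choose: "(t + 1 choose 2) = t + (t choose 2)" "(t + 2 choose 2) = 2 * t + 1 + (t choose 2)"
    by (simp_all add: numeral_2_eq_2)
  let ?b = "tutte_support_coeff (card E) l q rk \<kappa>"
  have "?b T = fact (r + 2) * \<kappa> ^ (t choose 2) * w T"
    "?b (insert i T) = fact (r + 1) * (\<kappa> ^ t * \<kappa> ^ (t choose 2)) * w (insert i T)"
    "?b (insert j T) = fact (r + 1) * (\<kappa> ^ t * \<kappa> ^ (t choose 2)) * w (insert j T)"
    "?b (insert i (insert j T)) = fact r * (\<kappa> ^ t * \<kappa> ^ t * \<kappa> * \<kappa> ^ (t choose 2))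
      * w (insert i (insert j T))"
    unfolding tutte_support_coeff_def cards choose w_def[symmetric]
    by (simp_all add: t_def[symmetric] cards(4) power_add mult_2)
  then have "?b T * ?b (insert i (insert j T)) / (?b (insert i T) * ?b (insert j T))
    = (fact (r + 2) * fact r / (fact (r + 1) * fact (r + 1))) * \<kappa>
      * (w T * w (insert i (insert j T)) / (w (insert i T) * w (insert j T)))"
    using assms(6) by (simp add: mult_ac)
  also have "(fact (r + 2) * fact r / (fact (r + 1) * fact (r + 1)) :: real) = N / (N - 1)"
  proof -
    have "fact (r + 1) = real (r + 1) * fact r"
      "fact (r + 2) = real (r + 2) * (real (r + 1) * fact r)"
      by (simp_all add: numeral_2_eq_2)
    then show ?thesis unfolding N by (simp add: mult_ac del: fact_Suc)
  qed
  also have "w T * w (insert i (insert j T)) / (w (insert i T) * w (insert j T))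
      = 1 - flag_kernel rk' q {1..l} i j"
    using w[of "insert i T"] w[of "insert j T"] by (simp add: ratio)
  finally show ?thesis using False by (simp add: gap_matrix_def mult.commute)
qed

text \<open>
  For \<open>\<kappa> = 1\<close> the form is \<open>(N Q - Z) / (N - 1)\<close>, where \<open>Q\<close> is the form of the flag kernel and \<open>Z\<close>
  is the squared sum of the coordinates. It is nonnegative, but it may vanish: if the
  contractions by \<open>T\<close> are uniform of rank at least two, it does so on constant vectors. For
  smaller \<open>\<kappa>\<close> the form is \<open>\<kappa>\<close> times this one plus \<open>(1 - \<kappa>) Z\<close>, which removes the degeneracy. In
  the proof \<open>Q\<close> is split as \<open>\<kappa> Q + (1 - \<kappa>) Q\<close>: the first part makes up for the negative
  coefficient that \<open>Z\<close> may have, and the second part gives the gap.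
\<close>

lemma tutte_gap:
  assumes flag: "flag_matroid E l rk"
    and q: "\<And>k. k \<in> {1..l} \<Longrightarrow> 0 < q k \<and> q k \<le> 1"
    and "finite E" "T \<subseteq> E" "card T + 2 \<le> card E" "0 < \<kappa>" "\<kappa> < 1"
  shows "\<kappa> * (1 - \<kappa>) * (\<Prod>k\<in>{1..l}. q k) * (\<Sum>i\<in>E - T. (z i)\<^sup>2)
    \<le> qform (E - T) (gap_matrix (tutte_support_coeff (card E) l q rk \<kappa>) T) z"
proof -
  define rk' where "rk' k S = rk k (S \<union> T) - rk k T" for k S
  define N where "N = real (card (E - T))"
  define \<theta> where "\<theta> = \<kappa> * N / (N - 1)"
  define Z where "Z = (\<Sum>i\<in>E - T. z i)\<^sup>2"
  define s where "s = (\<Sum>i\<in>E - T. (z i)\<^sup>2)"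
  define \<rho> where "\<rho> = (\<Prod>k\<in>{1..l}. q k)"
  define Q where "Q = qform (E - T) (flag_kernel rk' q {1..l}) z"
  have N: "N \<ge> 2"
    using assms(3-5) by (simp add: N_def card_Diff_subset finite_subset)
  have flag': "flag_matroid (E - T) l rk'"
    using flag_matroid_contraction[OF flag assms(4)] by (simp add: rk'_def[abs_def])
  have Q: "Z \<le> N * Q" "\<rho> * s \<le> Q"
    unfolding Z_def N_def Q_def \<rho>_def s_def
    using flag_kernel_bounds[where q = q, OF flag' q, of 1 "E - T" z] assms(3) by auto
  have s: "0 \<le> \<rho> * s"
    unfolding \<rho>_def s_def using q by (intro mult_nonneg_nonneg prod_nonneg sum_nonneg) (auto intro: less_imp_le)
  have Z: "Z \<ge> 0" by (simp add: Z_def)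
  have \<theta>: "\<theta> \<ge> \<kappa>" using N assms(6) by (simp add: \<theta>_def field_simps)
  have "qform (E - T) (gap_matrix (tutte_support_coeff (card E) l q rk \<kappa>) T) z
      = qform (E - T) (\<lambda>i j. (1 - \<theta>) * 1 + \<theta> * flag_kernel rk' q {1..l} i j) z"
  proof (rule qform_cong)
    fix i j assume ij: "i \<in> E - T" "j \<in> E - T"
    have "gap_matrix (tutte_support_coeff (card E) l q rk \<kappa>) T i j
        = 1 - \<theta> * (1 - flag_kernel rk' q {1..l} i j)"
      unfolding rk'_def[abs_def] N_def \<theta>_def
      by (rule tutte_gap_matrix[OF flag q assms(3-6) ij])
    then show "gap_matrix (tutte_support_coeff (card E) l q rk \<kappa>) T i j
        = (1 - \<theta>) * 1 + \<theta> * flag_kernel rk' q {1..l} i j"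
      by (simp only: right_diff_distrib mult_1_right)
  qed
  also have "\<dots> = (1 - \<theta>) * Z + \<theta> * Q"
    by (simp only: qform_add qform_mult qform_one Z_def Q_def)
  also have "\<dots> \<ge> \<kappa> * (1 - \<kappa>) * (\<rho> * s)"
  proof -
    have "0 \<le> 1 - \<theta> + \<theta> * \<kappa> / N"
    proof -
      have "1 - \<theta> + \<theta> * \<kappa> / N = (1 - \<kappa>) * (N - 1 - \<kappa>) / (N - 1)"
      proof -
        have e: "\<theta> * \<kappa> / N = \<kappa> * \<kappa> / (N - 1)" "N / (N - 1) - 1 / (N - 1) = 1"
          using N by (simp_all add: \<theta>_def flip: diff_divide_distrib)
        have "1 - \<theta> + \<theta> * \<kappa> / N = (N - 1 - \<kappa> * N + \<kappa> * \<kappa>) / (N - 1)"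
          by (simp only: e add_divide_distrib diff_divide_distrib \<theta>_def[symmetric])
        also have "N - 1 - \<kappa> * N + \<kappa> * \<kappa> = (1 - \<kappa>) * (N - 1 - \<kappa>)"
          by (simp add: algebra_simps)
        finally show ?thesis .
      qed
      then show ?thesis using N assms(7) by simp
    qed
    then have "0 \<le> (1 - \<theta> + \<theta> * \<kappa> / N) * Z" using Z by simp
    also have "\<dots> = (1 - \<theta>) * Z + \<theta> * \<kappa> * (Z / N)" by (simp add: algebra_simps)
    finally have 1: "0 \<le> (1 - \<theta>) * Z + \<theta> * \<kappa> * (Z / N)" .
    have "Z / N \<le> Q" using Q(1) N by (simp add: field_simps)
    then have 2: "\<theta> * \<kappa> * (Z / N) \<le> \<theta> * \<kappa> * Q"
      using \<theta> assms(6) by (intro mult_left_mono) auto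
    have "\<kappa> * (1 - \<kappa>) * (\<rho> * s) \<le> \<theta> * (1 - \<kappa>) * Q"
      using \<theta> assms(6,7) Q(2) s by (intro mult_mono mult_right_mono) auto
    with 1 2 show ?thesis by (simp add: algebra_simps)
  qed
  finally show ?thesis by (simp add: \<rho>_def s_def mult.assoc)
qed

definition tutte_monomial :: "nat \<Rightarrow> nat set \<Rightarrow> (nat \<Rightarrow>\<^sub>0 nat)" where
  "tutte_monomial n S = Poly_Mapping.single 0 (n - card S) + (\<Sum>i\<in>S. unit_exp i)"

lemma Var_power: "Var i ^ k = Poly_Mapping.single (Poly_Mapping.single i k) 1"
proof (induction k)
  case (Suc k)
  have "Poly_Mapping.single i 1 + Poly_Mapping.single i k = Poly_Mapping.single i (Suc k)"
    by (simp flip: single_add)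
  then show ?case
    unfolding power_Suc Suc by (simp add: Var_def mult_single del: One_nat_def)
qed simp

lemma prod_Var:
  assumes "finite S"
  shows "(\<Prod>i\<in>S. Var i) = Poly_Mapping.single (\<Sum>i\<in>S. unit_exp i) 1"
  using assms by (induction S) (simp_all add: Var_def unit_exp_def mult_single del: One_nat_def)

lemma tutte_poly_eq:
  "tutte_poly n l q rk
     = (\<Sum>S\<in>Pow {1..n}. Poly_Mapping.single (tutte_monomial n S) (tutte_weight l q rk S))"
  unfolding tutte_poly_def
proof (rule sum.cong)
  fix S assume "S \<in> Pow {1..n}"
  then have "finite S" by (auto intro: finite_subset)
  then show "Const (\<Prod>k = 1..l. q k powi - int (rk k S)) * Var 0 ^ (n - card S) * prod Var S
      = Poly_Mapping.single (tutte_monomial n S) (tutte_weight l q rk S)"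
    by (simp add: prod_Var Var_power Const_def mult_single tutte_monomial_def tutte_weight_def)
qed simp

lemma lookup_tutte_monomial:
  assumes "S \<subseteq> {1..n}"
  shows "Poly_Mapping.lookup (tutte_monomial n S) i
    = (if i = 0 then n - card S else if i \<in> S then 1 else 0)"
proof -
  have "finite S" "0 \<notin> S" using assms finite_subset by auto
  then show ?thesis
    by (simp add: tutte_monomial_def lookup_add lookup_sum lookup_single when_def unit_exp_def)
qed

text \<open>
  The monomials of the Tutte polynomial are those of degree \<open>n\<close> that are squarefree in
  \<open>w\<^sub>1, \<dots>, w\<^sub>n\<close>, and each comes from exactly one set, its support in \<open>{1..n}\<close>.
\<close>

lemma tutte_monomial_eq_iff:
  assumes "S \<subseteq> {1..n}"
  shows "tutte_monomial n S = m \<longleftrightarrow> m \<in> monomials {0..n} n \<and>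
    (\<forall>i\<in>{1..n}. Poly_Mapping.lookup m i \<le> 1) \<and> S = Poly_Mapping.keys m \<inter> {1..n}"
proof -
  have fin: "finite S" and card: "card S \<le> n"
    using assms finite_subset card_mono[OF _ assms] by auto
  have I: "{0..n} = insert 0 {1..n}" by auto
  show ?thesis
  proof
    assume m: "tutte_monomial n S = m"
    have l: "Poly_Mapping.lookup m i = (if i = 0 then n - card S else if i \<in> S then 1 else 0)" for i
      unfolding m[symmetric] by (rule lookup_tutte_monomial[OF assms])
    have "(\<Sum>i\<in>{1..n}. Poly_Mapping.lookup m i) = (\<Sum>i\<in>S. 1)"
      by (rule sum.mono_neutral_cong_right) (use assms in \<open>auto simp: l\<close>)
    moreover have "Poly_Mapping.keys m \<subseteq> {0..n}"
      using assms by (auto simp: in_keys_iff l split: if_splits)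
    ultimately have "m \<in> monomials {0..n} n"
      using card by (simp add: monomials_iff I l)
    moreover have "S = Poly_Mapping.keys m \<inter> {1..n}"
      using assms by (auto simp: in_keys_iff l split: if_splits)
    ultimately show "m \<in> monomials {0..n} n \<and>
      (\<forall>i\<in>{1..n}. Poly_Mapping.lookup m i \<le> 1) \<and> S = Poly_Mapping.keys m \<inter> {1..n}"
      by (simp add: l)
  next
    assume m: "m \<in> monomials {0..n} n \<and>
      (\<forall>i\<in>{1..n}. Poly_Mapping.lookup m i \<le> 1) \<and> S = Poly_Mapping.keys m \<inter> {1..n}"
    have one: "Poly_Mapping.lookup m i = 1" if "i \<in> S" for i
    proof -
      have "i \<in> {1..n}" "Poly_Mapping.lookup m i \<noteq> 0"
        using m that by (simp_all add: in_keys_iff)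
      moreover from this(1) have "Poly_Mapping.lookup m i \<le> 1" using m by blast
      ultimately show ?thesis by linarith
    qed
    have zero: "Poly_Mapping.lookup m i = 0" if "i \<notin> S" "i \<noteq> 0" for i
      using m that by (auto simp: monomials_def in_keys_iff Suc_le_eq)
    have "(\<Sum>i\<in>{1..n}. Poly_Mapping.lookup m i) = (\<Sum>i\<in>S. 1)"
      by (rule sum.mono_neutral_cong_right) (use assms one zero in auto)
    then have "Poly_Mapping.lookup m 0 + card S = n"
      using m by (simp add: monomials_iff I)
    then show "tutte_monomial n S = m"
      using one zero assms by (intro poly_mapping_eqI) (auto simp: lookup_tutte_monomial)
  qed
qed

definition deformed_tutte_poly ::
    "nat \<Rightarrow> nat \<Rightarrow> (nat \<Rightarrow> real) \<Rightarrow> (nat \<Rightarrow> nat set \<Rightarrow> nat) \<Rightarrow> real \<Rightarrow> real \<Rightarrow> nat rpoly" where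
  "deformed_tutte_poly n l q rk \<kappa> \<delta> = normalized_poly {0..n} n
     (deformed_coeff {1..n} (tutte_support_coeff n l q rk \<kappa>) \<delta>)"

text \<open>
  For \<open>\<delta> = 0\<close> the power of \<open>\<delta>\<close> is \<open>0 ^ 0 = 1\<close> on monomials squarefree in
  \<open>w\<^sub>1, \<dots>, w\<^sub>n\<close> and \<open>0\<close> on all others.
\<close>

lemma deformed_tutte_poly_1_0: "deformed_tutte_poly n l q rk 1 0 = tutte_poly n l q rk"
proof (rule poly_mapping_eqI)
  fix m :: "nat \<Rightarrow>\<^sub>0 nat"
  define S where "S = Poly_Mapping.keys m \<inter> {1..n}"
  define good where "good \<longleftrightarrow> m \<in> monomials {0..n} n \<and> (\<forall>i\<in>{1..n}. Poly_Mapping.lookup m i \<le> 1)"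
  have I: "{0..n} = insert 0 {1..n}" by auto
  have "Poly_Mapping.lookup (tutte_poly n l q rk) m
      = (\<Sum>S'\<in>Pow {1..n}. if S' = S then (if good then tutte_weight l q rk S else 0) else 0)"
    unfolding tutte_poly_eq lookup_sum lookup_single
    by (rule sum.cong) (auto simp: when_def tutte_monomial_eq_iff S_def good_def)
  also have "\<dots> = (if good then tutte_weight l q rk S else 0)"
    by (simp add: S_def)
  also have "\<dots> = Poly_Mapping.lookup (deformed_tutte_poly n l q rk 1 0) m"
  proof (cases good)
    case True
    then have "tutte_monomial n S = m"
      by (simp add: tutte_monomial_eq_iff S_def good_def)
    then have l: "Poly_Mapping.lookup m i = (if i = 0 then n - card S else if i \<in> S then 1 else 0)"
      for i using lookup_tutte_monomial[of S n i] by (simp add: S_def)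
    have "(\<Prod>i\<in>{1..n}. fact (Poly_Mapping.lookup m i) :: real) = 1"
      by (rule prod.neutral) (simp add: l)
    then have "mfact {0..n} m = fact (n - card S)" by (simp add: mfact_def I l)
    moreover have none: "(\<Sum>i\<in>{1..n}. Poly_Mapping.lookup m i choose 2) = 0"
      by (rule sum.neutral) (simp add: l)
    ultimately show ?thesis
      using True
      unfolding deformed_tutte_poly_def lookup_normalized_poly[OF finite_atLeastAtMost]
        deformed_coeff_def none S_def[symmetric] tutte_support_coeff_def
      by (simp add: good_def)
  next
    case False
    have "0 < (\<Sum>i\<in>{1..n}. Poly_Mapping.lookup m i choose 2)" if m: "m \<in> monomials {0..n} n"
    proof -
      obtain i where "i \<in> {1..n}" "\<not> Poly_Mapping.lookup m i \<le> 1"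
        using False m unfolding good_def by blast
      then show ?thesis by (intro sum_pos2[of _ i]) (auto simp: zero_less_binomial_iff)
    qed
    then show ?thesis
      using False
      by (simp add: deformed_tutte_poly_def lookup_normalized_poly deformed_coeff_def zero_power)
  qed
  finally show "Poly_Mapping.lookup (deformed_tutte_poly n l q rk 1 0) m
      = Poly_Mapping.lookup (tutte_poly n l q rk) m" ..
qed

text \<open>
  The coefficients are polynomials in \<open>\<kappa>\<close> and \<open>\<delta>\<close>.
\<close>

lemma tendsto_deformed_tutte_poly:
  assumes "(\<kappa> \<longlongrightarrow> x) F" "(\<delta> \<longlongrightarrow> y) F"
  shows "((\<lambda>k. Poly_Mapping.lookup (deformed_tutte_poly n l q rk (\<kappa> k) (\<delta> k)) m)
    \<longlongrightarrow> Poly_Mapping.lookup (deformed_tutte_poly n l q rk x y) m) F"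
proof -
  have "mfact {0..n} m \<noteq> 0" using mfact_pos[of "{0..n}" m] by simp
  then show ?thesis
    unfolding deformed_tutte_poly_def lookup_normalized_poly[OF finite_atLeastAtMost]
      deformed_coeff_def tutte_support_coeff_def
    by (cases "m \<in> monomials {0..n} n") (auto intro!: tendsto_intros assms)
qed

lemma eventually_strictly_lorentzian_deformed_tutte:
  assumes flag: "flag_matroid {1..n} l rk"
    and q: "\<And>k. k \<in> {1..l} \<Longrightarrow> 0 < q k \<and> q k \<le> 1"
    and "0 < \<kappa>" "\<kappa> < 1"
  shows "\<forall>\<^sub>F \<delta> in at_right 0. strictly_lorentzian {0..n} n (deformed_tutte_poly n l q rk \<kappa> \<delta>)"
proof -
  have I: "{0..n} = insert 0 {1..n}" by auto
  show ?thesis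
    unfolding deformed_tutte_poly_def I
  proof (rule eventually_strictly_lorentzian_deformed)
    show "0 < \<kappa> * (1 - \<kappa>) * (\<Prod>k\<in>{1..l}. q k)"
      using assms(3,4) q by (intro mult_pos_pos prod_pos) auto
    show "tutte_support_coeff n l q rk \<kappa> S > 0" for S
      using assms(3) tutte_weight_pos[where q = q, OF q, of l rk S] by (simp add: tutte_support_coeff_def)
    show "\<kappa> * (1 - \<kappa>) * (\<Prod>k\<in>{1..l}. q k) * (\<Sum>i\<in>{1..n} - T. (z i)\<^sup>2)
        \<le> qform ({1..n} - T) (gap_matrix (tutte_support_coeff n l q rk \<kappa>) T) z"
      if "T \<subseteq> {1..n}" "card T + 2 \<le> n" for T z
      using tutte_gap[where q = q, OF flag q, of T \<kappa> z] that assms(3,4) by simp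
  qed auto
qed

theorem theorem4p4:
  fixes n l :: nat
    and rk :: "nat \<Rightarrow> nat set \<Rightarrow> nat"
    and q :: "nat \<Rightarrow> real"
  assumes "n \<ge> 2" and "l \<ge> 1"
    and "flag_matroid {1..n} l rk"
    and "\<And>k. k \<in> {1..l} \<Longrightarrow> 0 < q k \<and> q k \<le> 1"
  shows "lorentzian {0..n} n (tutte_poly n l q rk)"
proof -
  \<comment> \<open>The admissible size of \<open>\<delta>\<close> depends on \<open>\<kappa>\<close>, so \<open>\<kappa> k\<close> is fixed first and \<open>\<delta> k\<close> is chosen after it.\<close>
  define \<kappa> :: "nat \<Rightarrow> real" where "\<kappa> k = real (Suc k) / real (Suc (Suc k))" for k
  have "\<exists>\<delta>. 0 < \<delta> \<and> \<delta> < 1 / real (Suc k) \<and>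
      strictly_lorentzian {0..n} n (deformed_tutte_poly n l q rk (\<kappa> k) \<delta>)" for k
  proof -
    have "\<forall>\<^sub>F \<delta> in at_right 0. strictly_lorentzian {0..n} n (deformed_tutte_poly n l q rk (\<kappa> k) \<delta>)"
      by (rule eventually_strictly_lorentzian_deformed_tutte[OF assms(3,4)]) (simp_all add: \<kappa>_def)
    moreover have "\<forall>\<^sub>F \<delta> in at_right 0. 0 < \<delta> \<and> \<delta> < 1 / real (Suc k)"
      unfolding eventually_at_right_field by (intro exI[of _ "1 / real (Suc k)"]) simp
    ultimately have "\<forall>\<^sub>F \<delta> in at_right 0. 0 < \<delta> \<and> \<delta> < 1 / real (Suc k) \<and>
        strictly_lorentzian {0..n} n (deformed_tutte_poly n l q rk (\<kappa> k) \<delta>)"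
      by eventually_elim simp
    then show ?thesis
      using eventually_happens' trivial_limit_at_right_real by blast
  qed
  then obtain \<delta> where \<delta>: "\<And>k. 0 < \<delta> k" "\<And>k. \<delta> k < 1 / real (Suc k)"
    "\<And>k. strictly_lorentzian {0..n} n (deformed_tutte_poly n l q rk (\<kappa> k) (\<delta> k))"
    by metis
  have "\<kappa> \<longlonglongrightarrow> 1"
    unfolding \<kappa>_def using LIMSEQ_Suc[OF LIMSEQ_n_over_Suc_n] by simp
  moreover have "\<delta> \<longlonglongrightarrow> 0"
    by (rule tendsto_sandwich[OF _ _ tendsto_const LIMSEQ_Suc[OF lim_1_over_n]])
       (use \<delta>(1,2) in \<open>auto intro!: always_eventually less_imp_le\<close>)
  ultimately have "(\<lambda>k. Poly_Mapping.lookup (deformed_tutte_poly n l q rk (\<kappa> k) (\<delta> k)) m)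
      \<longlonglongrightarrow> Poly_Mapping.lookup (tutte_poly n l q rk) m" for m
    using tendsto_deformed_tutte_poly[of \<kappa> 1 sequentially \<delta> 0] by (simp add: deformed_tutte_poly_1_0)
  with \<delta>(3) show ?thesis
    unfolding lorentzian_def
    by (intro exI[of _ "\<lambda>k. deformed_tutte_poly n l q rk (\<kappa> k) (\<delta> k)"] conjI allI)
qed

end
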